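(* Let $X(a_1,a_2,a_3,a_4)$ be a Kollár surface. Then $X(a_1,a_2,a_3,a_4)$ is birational to Kollár surfaces $X(a'_1,a'_2,a'_3,a'_4)\subset\mathbb{P}(w'_1,w'_2,w'_3,w'_4)$ with $\gcd(w'_1,w'_3)=\gcd(w'_2,w'_4)=1$, for infinitely many $4$-tuples $(a'_1,a'_2,a'_3,a'_4)$.
   Context: The ground field is $\mathbb{C}$; indices are taken modulo $4$. Let $a_1,\dots,a_4$ be positive integers with $(a_i,a_{i+2})\neq(1,1)$ for all $i$. Put $W_i=a_{i+1}a_{i+2}a_{i+3}-a_{i+2}a_{i+3}+a_{i+3}-1$, $w^*=\gcd(W_1,\dots,W_4)$, $w_i=W_i/w^*$. The Kollár surface is $X(a_1,a_2,a_3,a_4)=(x_1^{a_1}x_2+x_2^{a_2}x_3+x_3^{a_3}x_4+x_4^{a_4}x_1=0)\subset\mathbb{P}(w_1,w_2,w_3,w_4)$. The weights $w'_i$ are those associated in the same way to $(a'_1,\dots,a'_4)$. *)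

theory Defs
  imports "HOL-Analysis.Analysis"
begin

section \<open>Weighted projective spaces over the complex numbers\<close>

definition wscale :: "('n::finite \<Rightarrow> nat) \<Rightarrow> complex \<Rightarrow> complex ^ 'n \<Rightarrow> complex ^ 'n" where
  "wscale w t x = (\<chi> i. t ^ w i * x $ i)"

definition worbit :: "('n::finite \<Rightarrow> nat) \<Rightarrow> complex ^ 'n \<Rightarrow> (complex ^ 'n) set" where
  "worbit w x = {wscale w t x | t. t \<noteq> 0}"

text \<open>A point of the weighted projective space is an orbit of the multiplicative group on the
  nonzero vectors, taken as a set. The weights are meant to be positive.\<close>

definition wproj :: "('n::finite \<Rightarrow> nat) \<Rightarrow> (complex ^ 'n) set set" where
  "wproj w = worbit w ` (UNIV - {0})"

text \<open>Polynomials are represented by the functions they induce, which loses nothing over an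
  infinite field. The function \<open>m\<close> is the exponent of a monomial; the zero polynomial is
  homogeneous of every degree.\<close>

definition whomog :: "('n::finite \<Rightarrow> nat) \<Rightarrow> nat \<Rightarrow> (complex ^ 'n \<Rightarrow> complex) \<Rightarrow> bool" where
  "whomog w d f \<longleftrightarrow>
    (\<exists>(M :: ('n \<Rightarrow> nat) set) c. finite M \<and> (\<forall>m\<in>M. (\<Sum>i\<in>UNIV. w i * m i) = d) \<and>
      f = (\<lambda>x. \<Sum>m\<in>M. c m * (\<Prod>i\<in>UNIV. x $ i ^ m i)))"

definition wzeros :: "('n::finite \<Rightarrow> nat) \<Rightarrow> (complex ^ 'n \<Rightarrow> complex) set \<Rightarrow> (complex ^ 'n) set set" where
  "wzeros w S = {p \<in> wproj w. \<forall>x\<in>p. \<forall>f\<in>S. f x = 0}"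

definition wclosed :: "('n::finite \<Rightarrow> nat) \<Rightarrow> (complex ^ 'n) set set \<Rightarrow> bool" where
  "wclosed w C \<longleftrightarrow> (\<exists>S. (\<forall>f\<in>S. \<exists>d. whomog w d f) \<and> C = wzeros w S)"

definition zariski :: "('n::finite \<Rightarrow> nat) \<Rightarrow> (complex ^ 'n) set topology" where
  "zariski w = topology (\<lambda>U. \<exists>C. wclosed w C \<and> U = wproj w - C)"

lemma whomog_scale:
  assumes "whomog w d f"
  shows "f (wscale w t x) = t ^ d * f x"
proof -
  obtain M c where M: "\<forall>m\<in>M. (\<Sum>i\<in>UNIV. w i * m i) = d"
    and f: "f = (\<lambda>x. \<Sum>m\<in>M. c m * (\<Prod>i\<in>UNIV. x $ i ^ m i))"
    using assms by (auto simp: whomog_def)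
  have "(\<Prod>i\<in>UNIV. wscale w t x $ i ^ m i) = t ^ d * (\<Prod>i\<in>UNIV. x $ i ^ m i)" if "m \<in> M" for m
  proof -
    have "(\<Prod>i\<in>UNIV. t ^ (w i * m i)) = t ^ d"
      using M that by (simp flip: power_sum)
    then show ?thesis
      by (simp add: wscale_def power_mult_distrib prod.distrib power_mult)
  qed
  then show ?thesis
    unfolding f sum_distrib_left by (intro sum.cong) simp_all
qed

lemma whomog_mult:
  fixes w :: "'n::finite \<Rightarrow> nat"
  assumes "whomog w d f" and "whomog w e g"
  shows "whomog w (d + e) (\<lambda>x. f x * g x)"
proof -
  obtain M c where M: "finite M" "\<forall>m\<in>M. (\<Sum>i\<in>UNIV. w i * m i) = d"
    and f: "f = (\<lambda>x. \<Sum>m\<in>M. c m * (\<Prod>i\<in>UNIV. x $ i ^ m i))"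
    using assms(1) by (auto simp: whomog_def)
  obtain N b where N: "finite N" "\<forall>m\<in>N. (\<Sum>i\<in>UNIV. w i * m i) = e"
    and g: "g = (\<lambda>x. \<Sum>m\<in>N. b m * (\<Prod>i\<in>UNIV. x $ i ^ m i))"
    using assms(2) by (auto simp: whomog_def)
  define h where "h = (\<lambda>(m, n) (i :: 'n). m i + n i :: nat)"
  define K where "K = h ` (M \<times> N)"
  define a where "a = (\<lambda>k. \<Sum>p\<in>{p \<in> M \<times> N. h p = k}. c (fst p) * b (snd p))"
  have "f x * g x = (\<Sum>k\<in>K. a k * (\<Prod>i\<in>UNIV. x $ i ^ k i))" for x
  proof -
    have "f x * g x = (\<Sum>p\<in>M \<times> N. c (fst p) * b (snd p) * (\<Prod>i\<in>UNIV. x $ i ^ h p i))"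
      unfolding f g sum_product sum.cartesian_product
      by (rule sum.cong) (auto simp: h_def power_add prod.distrib mult_ac)
    also have "\<dots> = (\<Sum>k\<in>K. \<Sum>p\<in>{p \<in> M \<times> N. h p = k}.
        c (fst p) * b (snd p) * (\<Prod>i\<in>UNIV. x $ i ^ h p i))"
      unfolding K_def by (rule sum.image_gen) (simp add: M N)
    also have "\<dots> = (\<Sum>k\<in>K. a k * (\<Prod>i\<in>UNIV. x $ i ^ k i))"
      by (rule sum.cong) (auto simp: a_def sum_distrib_right intro!: sum.cong)
    finally show ?thesis .
  qed
  moreover have "\<forall>k\<in>K. (\<Sum>i\<in>UNIV. w i * k i) = d + e"
    using M N by (auto simp: K_def h_def distrib_left sum.distrib)
  moreover have "finite K"
    using M N by (simp add: K_def)
  ultimately show ?thesis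
    unfolding whomog_def by blast
qed

lemma whomog_const: "whomog w 0 (\<lambda>x. c)"
  unfolding whomog_def by (rule exI[of _ "{\<lambda>i. 0}"]) (auto intro!: exI[of _ "\<lambda>_. c"])

lemma whomog_zero_on_orbit:
  assumes "p \<in> wproj w" "whomog w d f" "x \<in> p" "y \<in> p" "f x = 0"
  shows "f y = 0"
  using assms by (auto simp: wproj_def worbit_def whomog_scale)

lemma istopology_zariski: "istopology (\<lambda>U. \<exists>C. wclosed w C \<and> U = wproj w - C)"
proof -
  have inter: "\<exists>E. wclosed w E \<and> (wproj w - C) \<inter> (wproj w - D) = wproj w - E"
    if C: "wclosed w C" and D: "wclosed w D" for C D
  proof -
    obtain S where S: "\<forall>f\<in>S. \<exists>d. whomog w d f" "C = wzeros w S"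
      using C by (auto simp: wclosed_def)
    obtain T where T: "\<forall>f\<in>T. \<exists>d. whomog w d f" "D = wzeros w T"
      using D by (auto simp: wclosed_def)
    define R where "R = {\<lambda>x. f x * g x | f g. f \<in> S \<and> g \<in> T}"
    have R: "\<forall>f\<in>R. \<exists>d. whomog w d f"
      unfolding R_def using S(1) T(1) whomog_mult by blast
    have "wzeros w R = C \<union> D"
    proof
      show "C \<union> D \<subseteq> wzeros w R"
        by (auto simp: S(2) T(2) wzeros_def R_def)
      show "wzeros w R \<subseteq> C \<union> D"
      proof
        fix p assume p: "p \<in> wzeros w R"
        show "p \<in> C \<union> D"
        proof (rule ccontr)
          assume "p \<notin> C \<union> D"
          then obtain x f y g where *: "x \<in> p" "f \<in> S" "f x \<noteq> 0" "y \<in> p" "g \<in> T" "g y \<noteq> 0"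
            using p by (auto simp: S(2) T(2) wzeros_def)
          moreover have "(\<lambda>x. f x * g x) \<in> R"
            using * by (auto simp: R_def)
          ultimately have "f x * g x = 0"
            using p by (fastforce simp: wzeros_def)
          then have "g x = 0" using * by simp
          moreover obtain d where "whomog w d g"
            using T(1) * by blast
          moreover have "p \<in> wproj w"
            using p by (simp add: wzeros_def)
          ultimately have "g y = 0"
            using whomog_zero_on_orbit * by blast
          then show False using * by simp
        qed
      qed
    qed
    then have "wclosed w (C \<union> D)"
      using R by (auto simp: wclosed_def)
    then show ?thesis by (intro exI[of _ "C \<union> D"]) blast
  qed
  have union: "\<exists>E. wclosed w E \<and> \<Union>\<K> = wproj w - E"
    if K: "\<forall>U\<in>\<K>. \<exists>C. wclosed w C \<and> U = wproj w - C" for \<K>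
  proof -
    have "\<forall>U\<in>\<K>. \<exists>S. (\<forall>f\<in>S. \<exists>d. whomog w d f) \<and> U = wproj w - wzeros w S"
      using K unfolding wclosed_def by metis
    then obtain S where S: "\<forall>U\<in>\<K>. (\<forall>f\<in>S U. \<exists>d. whomog w d f) \<and> U = wproj w - wzeros w (S U)"
      by metis
    define T where "T = (\<Union>U\<in>\<K>. S U)"
    have "\<Union>\<K> = (\<Union>U\<in>\<K>. wproj w - wzeros w (S U))"
      using S by auto
    also have "\<dots> = wproj w - wzeros w T"
      unfolding T_def wzeros_def by blast
    finally have "\<Union>\<K> = wproj w - wzeros w T" .
    moreover have "\<forall>f\<in>T. \<exists>d. whomog w d f"
      using S by (auto simp: T_def)
    ultimately show ?thesis
      unfolding wclosed_def by blast
  qed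
  show ?thesis
    unfolding istopology_def
  proof (intro conjI allI impI)
    fix U V assume "\<exists>C. wclosed w C \<and> U = wproj w - C" "\<exists>C. wclosed w C \<and> V = wproj w - C"
    then show "\<exists>C. wclosed w C \<and> U \<inter> V = wproj w - C"
      using inter by metis
  qed (use union in blast)
qed

lemma openin_zariski: "openin (zariski w) U \<longleftrightarrow> (\<exists>C. wclosed w C \<and> U = wproj w - C)"
  unfolding zariski_def by (subst topology_inverse'[OF istopology_zariski]) (rule refl)

lemma topspace_zariski: "topspace (zariski w) = wproj w"
proof -
  have "p \<noteq> {}" if "p \<in> wproj w" for p
    using that by (auto simp: wproj_def worbit_def intro!: exI[of _ 1])
  then have "{} = wzeros w {\<lambda>x. 1}"
    unfolding wzeros_def by auto
  then have "wclosed w {}"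
    unfolding wclosed_def
    by (intro exI[of _ "{\<lambda>x. 1}"] conjI ballI exI[of _ 0]) (auto intro: whomog_const)
  then have "openin (zariski w) (wproj w)"
    unfolding openin_zariski by (intro exI[of _ "{}"]) simp
  then show ?thesis
    by (auto simp: topspace_def openin_zariski)
qed


section \<open>Regular functions, morphisms and birational equivalence\<close>

text \<open>The sets \<open>U\<close>, \<open>V\<close>, \<open>X\<close>, \<open>Y\<close> below are locally closed in their weighted projective spaces
  and carry the induced topology.\<close>

definition regular_on ::
    "('n::finite \<Rightarrow> nat) \<Rightarrow> (complex ^ 'n) set set \<Rightarrow> ((complex ^ 'n) set \<Rightarrow> complex) \<Rightarrow> bool" where
  "regular_on w U f \<longleftrightarrow>
    (\<forall>p\<in>U. \<exists>N d g h. openin (subtopology (zariski w) U) N \<and> p \<in> N \<and>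
      whomog w d g \<and> whomog w d h \<and> (\<forall>q\<in>N. \<forall>x\<in>q. h x \<noteq> 0 \<and> f q = g x / h x))"

definition variety_morphism ::
    "('n::finite \<Rightarrow> nat) \<Rightarrow> (complex ^ 'n) set set \<Rightarrow> ('m::finite \<Rightarrow> nat) \<Rightarrow> (complex ^ 'm) set set \<Rightarrow>
      ((complex ^ 'n) set \<Rightarrow> (complex ^ 'm) set) \<Rightarrow> bool" where
  "variety_morphism w U v V \<phi> \<longleftrightarrow>
    continuous_map (subtopology (zariski w) U) (subtopology (zariski v) V) \<phi> \<and>
    (\<forall>N f. openin (subtopology (zariski v) V) N \<and> regular_on v N f \<longrightarrow>
      regular_on w {p \<in> U. \<phi> p \<in> N} (f \<circ> \<phi>))"

definition isomorphic_varieties ::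
    "('n::finite \<Rightarrow> nat) \<Rightarrow> (complex ^ 'n) set set \<Rightarrow> ('m::finite \<Rightarrow> nat) \<Rightarrow> (complex ^ 'm) set set \<Rightarrow> bool" where
  "isomorphic_varieties w U v V \<longleftrightarrow>
    (\<exists>\<phi> \<psi>. variety_morphism w U v V \<phi> \<and> variety_morphism v V w U \<psi> \<and>
      (\<forall>p\<in>U. \<psi> (\<phi> p) = p) \<and> (\<forall>q\<in>V. \<phi> (\<psi> q) = q))"

definition dense_open_in ::
    "('n::finite \<Rightarrow> nat) \<Rightarrow> (complex ^ 'n) set set \<Rightarrow> (complex ^ 'n) set set \<Rightarrow> bool" where
  "dense_open_in w X U \<longleftrightarrow>
    openin (subtopology (zariski w) X) U \<and> subtopology (zariski w) X closure_of U = X"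

definition birational ::
    "('n::finite \<Rightarrow> nat) \<Rightarrow> (complex ^ 'n) set set \<Rightarrow> ('m::finite \<Rightarrow> nat) \<Rightarrow> (complex ^ 'm) set set \<Rightarrow> bool" where
  "birational w X v Y \<longleftrightarrow>
    (\<exists>U V. dense_open_in w X U \<and> dense_open_in v Y V \<and> isomorphic_varieties w U v V)"


section \<open>Kollar surfaces\<close>

text \<open>A 4-tuple is a function on the type \<open>4\<close> of integers modulo 4, so index arithmetic is
  cyclic and the index 4 is the same as 0.\<close>

definition kollar_tuple :: "(4 \<Rightarrow> nat) \<Rightarrow> bool" where
  "kollar_tuple a \<longleftrightarrow> (\<forall>i. a i > 0) \<and> (\<forall>i. (a i, a (i + 2)) \<noteq> (1, 1))"

text \<open>The integer below equals $a_{i+2} a_{i+3} (a_{i+1} - 1) + (a_{i+3} - 1)$, so for the tuples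
  considered here it is positive and the conversion to \<^typ>\<open>nat\<close> does not truncate.\<close>

definition kollar_W :: "(4 \<Rightarrow> nat) \<Rightarrow> 4 \<Rightarrow> nat" where
  "kollar_W a i = nat (int (a (i + 1)) * int (a (i + 2)) * int (a (i + 3))
     - int (a (i + 2)) * int (a (i + 3)) + int (a (i + 3)) - 1)"

definition kollar_wstar :: "(4 \<Rightarrow> nat) \<Rightarrow> nat" where
  "kollar_wstar a = Gcd (range (kollar_W a))"

definition kollar_weight :: "(4 \<Rightarrow> nat) \<Rightarrow> 4 \<Rightarrow> nat" where
  "kollar_weight a i = kollar_W a i div kollar_wstar a"

definition kollar_poly :: "(4 \<Rightarrow> nat) \<Rightarrow> complex ^ 4 \<Rightarrow> complex" where
  "kollar_poly a x = (\<Sum>i\<in>UNIV. x $ i ^ a i * x $ (i + 1))"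

definition kollar_surface :: "(4 \<Rightarrow> nat) \<Rightarrow> (complex ^ 4) set set" where
  "kollar_surface a = wzeros (kollar_weight a) {kollar_poly a}"

lemma kollar_W_pos:
  assumes "kollar_tuple a"
  shows "kollar_W a i > 0"
proof -
  let ?b = "int (a (i + 1))" and ?c = "int (a (i + 2))" and ?d = "int (a (i + 3))"
  have "a j > 0" for j
    using assms by (simp add: kollar_tuple_def)
  from this[of "i + 1"] this[of "i + 2"] this[of "i + 3"]
  have pos: "?b \<ge> 1" "?c \<ge> 1" "?d \<ge> 1"
    by linarith+
  have "(a (i + 1), a (i + 1 + 2)) \<noteq> (1, 1)"
    using assms unfolding kollar_tuple_def by blast
  then have "?b \<noteq> 1 \<or> ?d \<noteq> 1"
    by (simp add: add.assoc)
  then have "?c * ?d * (?b - 1) + (?d - 1) > 0"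
    using pos by (cases "?b = 1") (auto intro!: add_pos_nonneg mult_pos_pos)
  then show ?thesis
    by (simp add: kollar_W_def algebra_simps)
qed

end

theory Submission
  imports Defs "HOL-Number_Theory.Cong" "HOL-Computational_Algebra.Fundamental_Theorem_Algebra"
begin

text \<open>The monomials \<open>y\<^sub>i = x\<^sub>i ^ a\<^sub>i x\<^sub>i\<^sub>+\<^sub>1\<close> map the part of a Kollar surface where no coordinate vanishes
  onto the complement of the coordinate lines in the plane \<open>y\<^sub>1 + y\<^sub>2 + y\<^sub>3 + y\<^sub>4 = 0\<close>. This map is a
  cyclic covering of degree \<open>w*\<close>, and the characters that define it depend only on the residues
  of the \<open>a\<^sub>i\<close> modulo \<open>w*\<close>. So a tuple \<open>a'\<close> that is congruent to \<open>a\<close> modulo \<open>w*\<close> and has the same \<open>w*\<close>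
  gives a birational surface, and it remains to find infinitely many such tuples with coprime
  opposite weights.

  The isomorphism between the two tori is a monomial map, with exponents \<open>B\<close> that satisfy
  \<open>A' B = A + (1, ..., 1)\<^sup>T r\<close> for the exponent matrices \<open>A\<close>, \<open>A'\<close> of the two equations; it pulls the
  second equation back to the first one times the monomial \<open>x\<^sup>r\<close>. Such a \<open>B\<close> exists because \<open>w*\<close> is the
  greatest common divisor of \<open>det A'\<close> and any single \<open>W'\<^sub>i\<close>
  (\<open>exponent_column_exists\<close>). The integral vectors with constant image under an exponent
  matrix are the multiples of the weight vector (\<open>cyclic_system_solution\<close>); therefore the map
  respects the weighted scalings, and composing two such maps in opposite directions gives a
  scaling, which is the identity on orbits (\<open>kollar_transfer_inverse\<close>). Moreover the torus is
  dense, because no coordinate hyperplane contains a component of the affine cone; this is shown by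
  perturbing points in the Euclidean topology (\<open>kollar_torus_points_dense\<close>).

  The new tuple comes from the Chinese remainder theorem
  (\<open>congruent_numbers_with_prescribed_gcds\<close>). As affine forms in \<open>a\<^sub>4\<close>, the numbers \<open>W\<^sub>1\<close> and \<open>W\<^sub>3\<close> have
  the resultant \<open>(a\<^sub>2 - 1) W\<^sub>4\<close> up to sign, and \<open>W\<^sub>4\<close> does not involve \<open>a\<^sub>4\<close>. So both coprimality
  conditions only restrict \<open>a\<^sub>4\<close> modulo finitely many primes, and arbitrarily large values
  of \<open>a\<^sub>4\<close> satisfy them.\<close>

section \<open>Indices modulo 4\<close>

lemma cyclic_4_add:
  "(i::4) + 4 = i" "i + 1 + 1 = i + 2" "i + 1 + 2 = i + 3" "i + 1 + 3 = i"
  "i + 2 + 1 = i + 3" "i + 2 + 2 = i" "i + 2 + 3 = i + 1"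
  "i + 3 + 1 = i" "i + 3 + 2 = i + 1" "i + 3 + 3 = i + 2"
proof -
  have "(4::4) = 0" "(1::4) + 1 = 2" "(1::4) + 2 = 3" "(1::4) + 3 = 0" "(2::4) + 1 = 3"
    "(2::4) + 2 = 0" "(2::4) + 3 = 1" "(3::4) + 1 = 0" "(3::4) + 2 = 1" "(3::4) + 3 = 2"
    by simp_all
  then show "i + 4 = i" "i + 1 + 1 = i + 2" "i + 1 + 2 = i + 3" "i + 1 + 3 = i"
    "i + 2 + 1 = i + 3" "i + 2 + 2 = i" "i + 2 + 3 = i + 1"
    "i + 3 + 1 = i" "i + 3 + 2 = i + 1" "i + 3 + 3 = i + 2"
    by (simp_all only: add.assoc add_0_right)
qed

lemma distinct_4_cyclic:
  "i + 1 \<noteq> (i :: 4)" "i + 2 \<noteq> (i :: 4)" "i + 3 \<noteq> (i :: 4)"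
  "i + 2 \<noteq> i + (1 :: 4)" "i + 3 \<noteq> i + (1 :: 4)" "i + 3 \<noteq> i + (2 :: 4)"
  using exhaust_4[of i] by auto

lemma UNIV_4_cyclic: "{i, i + 1, i + 2, i + 3} = (UNIV :: 4 set)"
proof (rule card_eq_UNIV_imp_eq_UNIV)
  show "card {i, i + 1, i + 2, i + 3} = CARD(4)"
    using distinct_4_cyclic[of i] distinct_4_cyclic[of i, symmetric] by simp
qed simp

lemma all_4_cyclic: "(\<forall>j :: 4. P j) \<longleftrightarrow> P i \<and> P (i + 1) \<and> P (i + 2) \<and> P (i + 3)"
  using UNIV_4_cyclic[of i] by (metis UNIV_I insertE singletonD)

lemma sum_4_cyclic: "sum f (UNIV :: 4 set) = f i + f (i + 1) + f (i + 2) + f (i + 3)"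
  by (subst UNIV_4_cyclic[of i, symmetric]) (simp add: add.assoc distinct_4_cyclic distinct_4_cyclic[symmetric])

lemma prod_4_cyclic: "prod f (UNIV :: 4 set) = f i * f (i + 1) * f (i + 2) * f (i + 3)"
  by (subst UNIV_4_cyclic[of i, symmetric]) (simp add: mult.assoc distinct_4_cyclic distinct_4_cyclic[symmetric])

section \<open>The weights and the exponent matrix of a Kollar surface\<close>

text \<open>The determinant of the \<open>4 \<times> 4\<close> matrix of exponents of the four monomials
  \<open>x\<^sub>i ^ a\<^sub>i x\<^sub>i\<^sub>+\<^sub>1\<close>.\<close>

definition kollar_det :: "(4 \<Rightarrow> nat) \<Rightarrow> int" where
  "kollar_det a = (\<Prod>i\<in>UNIV. int (a i)) - 1"

lemma int_kollar_W:
  assumes "kollar_tuple a"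
  shows "int (kollar_W a i) = int (a (i + 1)) * int (a (i + 2)) * int (a (i + 3))
     - int (a (i + 2)) * int (a (i + 3)) + int (a (i + 3)) - 1"
  using kollar_W_pos[OF assms, of i] unfolding kollar_W_def by linarith

text \<open>This is Cramer's rule for the exponent matrix with the constant right-hand side
  \<open>kollar_det a\<close>: it is why all four monomials have the same weighted degree.\<close>

lemma kollar_W_cyclic:
  assumes "kollar_tuple a"
  shows "int (a i) * int (kollar_W a i) + int (kollar_W a (i + 1)) = kollar_det a"
  by (simp add: int_kollar_W[OF assms] kollar_det_def prod_4_cyclic[of _ i] cyclic_4_add algebra_simps)

lemma kollar_wstar_dvd: "kollar_wstar a dvd kollar_W a i"
  unfolding kollar_wstar_def by simp

lemma kollar_wstar_pos:
  assumes "kollar_tuple a"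
  shows "kollar_wstar a > 0"
  using kollar_wstar_dvd[of a 1] kollar_W_pos[OF assms, of 1] by (cases "kollar_wstar a") auto

lemma kollar_W_eq: "kollar_W a i = kollar_wstar a * kollar_weight a i"
  unfolding kollar_weight_def using kollar_wstar_dvd by simp

lemma kollar_weight_pos:
  assumes "kollar_tuple a"
  shows "kollar_weight a i > 0"
  using kollar_W_pos[OF assms, of i] by (auto simp: kollar_W_eq intro: Nat.gr0I)

text \<open>The weights have no common factor, since \<open>w*\<close> is divided out.\<close>

lemma dvd_all_kollar_weight:
  assumes "kollar_tuple a" and "\<And>i. d dvd s * int (kollar_weight a i)"
  shows "d dvd s"
proof -
  let ?N = "kollar_wstar a"
  have "?N * Gcd (range (kollar_weight a)) = Gcd ((*) ?N ` range (kollar_weight a))"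
    by (simp add: Gcd_mult)
  also have "(*) ?N ` range (kollar_weight a) = range (kollar_W a)"
    by (auto simp: kollar_W_eq image_image)
  finally have "Gcd (range (kollar_weight a)) = 1"
    using kollar_wstar_pos[OF assms(1)] unfolding kollar_wstar_def
    by (metis mult_cancel_left mult.right_neutral not_gr_zero)
  moreover have "nat \<bar>d\<bar> dvd Gcd ((*) (nat \<bar>s\<bar>) ` range (kollar_weight a))"
  proof (rule Gcd_greatest)
    fix n assume "n \<in> (*) (nat \<bar>s\<bar>) ` range (kollar_weight a)"
    then obtain i where "n = nat \<bar>s\<bar> * kollar_weight a i" by blast
    then have "int n = \<bar>s * int (kollar_weight a i)\<bar>" by (simp add: abs_mult)
    then show "nat \<bar>d\<bar> dvd n"
      using assms(2)[of i] unfolding nat_abs_dvd_iff by simp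
  qed
  ultimately show ?thesis
    by (simp add: Gcd_mult)
qed

text \<open>By the cyclic relation a common divisor of the determinant and one \<open>W\<^sub>i\<close> also divides
  \<open>W\<^sub>i\<^sub>+\<^sub>1\<close>, hence all of them. So the greatest common divisor of the determinant and any
  single \<open>W\<^sub>i\<close> is already \<open>w*\<close>, which makes the Bezout argument below work.\<close>

lemma dvd_kollar_det_and_W:
  assumes "kollar_tuple a" and "g dvd kollar_det a" and "g dvd int (kollar_W a i)"
  shows "g dvd int (kollar_wstar a)"
proof -
  have step: "g dvd int (kollar_W a (k + 1))" if "g dvd int (kollar_W a k)" for k
  proof -
    have "int (kollar_W a (k + 1)) = kollar_det a - int (a k) * int (kollar_W a k)"
      using kollar_W_cyclic[OF assms(1), of k] by simp
    then show ?thesis using that assms(2) by simp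
  qed
  have 1: "g dvd int (kollar_W a (i + 1))" using step assms(3) by blast
  then have 2: "g dvd int (kollar_W a (i + 2))" using step[of "i + 1"] by (simp add: cyclic_4_add)
  then have "g dvd int (kollar_W a (i + 3))" using step[of "i + 2"] by (simp add: cyclic_4_add)
  with 1 2 assms(3) have "g dvd int (kollar_W a j)" for j
    using all_4_cyclic[of "\<lambda>j. g dvd int (kollar_W a j)" i] by blast
  then have "nat \<bar>g\<bar> dvd kollar_wstar a"
    unfolding kollar_wstar_def by (intro Gcd_greatest) (auto simp: nat_abs_dvd_iff)
  then show ?thesis by (simp only: nat_abs_dvd_iff)
qed

text \<open>The weighted degree of the equation. The first monomial is as good as any other, by
  \<open>kollar_weight_cyclic\<close>.\<close>

definition kollar_degree :: "(4 \<Rightarrow> nat) \<Rightarrow> nat" where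
  "kollar_degree a = a 1 * kollar_weight a 1 + kollar_weight a 2"

lemma kollar_det_eq:
  assumes "kollar_tuple a"
  shows "kollar_det a = int (kollar_wstar a) * int (kollar_degree a)"
  using kollar_W_cyclic[OF assms, of 1]
  by (simp add: kollar_degree_def kollar_W_eq algebra_simps)

lemma kollar_degree_pos:
  assumes "kollar_tuple a"
  shows "kollar_degree a > 0"
  using kollar_weight_pos[OF assms, of 2] by (simp add: kollar_degree_def)

lemma kollar_weight_cyclic:
  assumes "kollar_tuple a"
  shows "a i * kollar_weight a i + kollar_weight a (i + 1) = kollar_degree a"
proof -
  have "int (kollar_wstar a) * int (a i * kollar_weight a i + kollar_weight a (i + 1))
      = int (kollar_wstar a) * int (kollar_degree a)"
    using kollar_W_cyclic[OF assms, of i]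
    by (simp add: kollar_det_eq[OF assms] kollar_W_eq algebra_simps)
  then show ?thesis
    using kollar_wstar_pos[OF assms] by (simp flip: of_nat_mult of_nat_add)
qed

text \<open>Elimination around the cycle gives \<open>d v\<^sub>i = s w\<^sub>i\<close>, where \<open>d\<close> is the degree. As the weights are
  coprime, \<open>d\<close> divides \<open>s\<close>. An integral vector with constant image under the exponent matrix thus
  acts on the coordinates like an element of the scaling group.\<close>

lemma cyclic_system_solution:
  fixes v :: "4 \<Rightarrow> int"
  assumes a: "kollar_tuple a" and v: "\<And>i. int (a i) * v i + v (i + 1) = s"
  shows "\<exists>\<sigma>. \<forall>i. v i = \<sigma> * int (kollar_weight a i)"
proof -
  let ?d = "int (kollar_degree a)" and ?N = "int (kollar_wstar a)"
  have N: "?N > 0" and d: "?d > 0"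
    using kollar_wstar_pos[OF a] kollar_degree_pos[OF a] by auto
  have dv: "?d * v i = s * int (kollar_weight a i)" for i
  proof -
    have "v (i + 1) = s - int (a i) * v i" "v (i + 2) = s - int (a (i + 1)) * v (i + 1)"
      "v (i + 3) = s - int (a (i + 2)) * v (i + 2)" "v i = s - int (a (i + 3)) * v (i + 3)"
      using v[of i] v[of "i + 1"] v[of "i + 2"] v[of "i + 3"] by (simp_all add: cyclic_4_add)
    then have "kollar_det a * v i = s * int (kollar_W a i)"
      unfolding int_kollar_W[OF a] kollar_det_def prod_4_cyclic[of _ i] by algebra
    then have "?N * (?d * v i) = ?N * (s * int (kollar_weight a i))"
      by (simp add: kollar_det_eq[OF a] kollar_W_eq mult_ac)
    then show ?thesis using N by simp
  qed
  have "?d dvd s"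
    using dvd_all_kollar_weight[OF a] dv by (metis dvd_triv_left)
  then obtain \<sigma> where "s = ?d * \<sigma>" by blast
  then have "v i = \<sigma> * int (kollar_weight a i)" for i
    using dv[of i] d by (simp add: mult.assoc distinct_4_cyclic distinct_4_cyclic[symmetric])
  then show ?thesis by blast
qed

text \<open>Elimination around the cycle, starting from \<open>u = c\<^sub>j\<^sub>+\<^sub>1\<close>, leaves the single equation
  \<open>r W\<^sub>j\<^sub>+\<^sub>1 - u det = \<kappa>\<close>. It is solvable because the two coefficients have greatest common
  divisor \<open>w*\<close>.\<close>

lemma cyclic_system_solvable:
  assumes a: "kollar_tuple a" and \<kappa>: "int (kollar_wstar a) dvd \<kappa>"
  shows "\<exists>(c :: 4 \<Rightarrow> int) r. \<forall>i. int (a i) * c i + c (i + 1) = (if i = j then \<kappa> else 0) + r"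
proof -
  define g where "g = gcd (int (kollar_W a (j + 1))) (kollar_det a)"
  have "g dvd int (kollar_wstar a)"
    by (rule dvd_kollar_det_and_W[OF a, of _ "j + 1"]) (simp_all add: g_def)
  then obtain k where k: "\<kappa> = g * k" using \<kappa> by (metis dvd_def dvd_trans)
  obtain x y where "x * int (kollar_W a (j + 1)) + y * kollar_det a = g"
    unfolding g_def using bezout_int by blast
  then have ru: "(x * k) * int (kollar_W a (j + 1)) + (y * k) * kollar_det a = \<kappa>"
    unfolding k by (metis distrib_right mult.assoc mult.commute)
  define r u where "r = x * k" and "u = - y * k"
  define c1 where "c1 = r - int (a (j + 1)) * u"
  define c2 where "c2 = r - int (a (j + 2)) * c1"
  define c3 where "c3 = r - int (a (j + 3)) * c2"
  define c where "c = (\<lambda>i. if i = j + 1 then u else if i = j + 2 then c1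
    else if i = j + 3 then c2 else c3)"
  have "int (a j) * c3 + u = \<kappa> + r"
    using ru unfolding int_kollar_W[OF a] kollar_det_def prod_4_cyclic[of _ j] cyclic_4_add
      r_def u_def c1_def c2_def c3_def by (simp add: algebra_simps)
  then have "\<forall>i. int (a i) * c i + c (i + 1) = (if i = j then \<kappa> else 0) + r"
    unfolding all_4_cyclic[of _ j]
    by (simp add: c_def c1_def c2_def c3_def cyclic_4_add distinct_4_cyclic distinct_4_cyclic[symmetric])
  then show ?thesis by blast
qed

text \<open>Column \<open>j\<close> of the exponents of a monomial map between the surfaces of \<open>a\<close> and \<open>a'\<close>. The unit
  vector \<open>e\<^sub>j\<close> solves the system up to the error \<open>a\<^sub>j - a'\<^sub>j\<close> in the equation with index \<open>j\<close>,
  which is corrected with the previous lemma. A large multiple of the weight vector, whose image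
  is constant and thus only changes \<open>r\<close>, then makes all the exponents nonnegative, so that the map
  is polynomial.\<close>

lemma exponent_column_exists:
  assumes a': "kollar_tuple a'" and N: "int (kollar_wstar a') dvd int (a j) - int (a' j)"
  shows "\<exists>(b :: 4 \<Rightarrow> nat) r. \<forall>i. a' i * b i + b (i + 1)
    = (if i = j then a i else 0) + (if i + 1 = j then 1 else 0) + r"
proof -
  obtain c r where c: "\<And>i. int (a' i) * c i + c (i + 1)
      = (if i = j then int (a j) - int (a' j) else 0) + r"
    using cyclic_system_solvable[OF a' N] by metis
  define t where "t = (\<Sum>i\<in>UNIV. \<bar>c i\<bar>) + \<bar>r\<bar>"
  let ?w = "\<lambda>i. int (kollar_weight a' i)" and ?d = "int (kollar_degree a')"
  define b where "b = (\<lambda>i. (if i = j then 1 else 0) + c i + t * ?w i)"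
  have t: "t \<ge> 0" "\<bar>r\<bar> \<le> t"
    unfolding t_def by (simp_all add: sum_nonneg)
  have ct: "\<bar>c i\<bar> \<le> t" for i
  proof -
    have "\<bar>c i\<bar> \<le> (\<Sum>i\<in>UNIV. \<bar>c i\<bar>)"
      by (rule member_le_sum) auto
    then show ?thesis unfolding t_def by simp
  qed
  have scale: "t \<le> t * int k" if "k > 0" for k
    using mult_left_mono[of 1 "int k" t] that t(1) by simp
  have b: "b i \<ge> 0" for i
    using ct[of i] scale[OF kollar_weight_pos[OF a', of i]] unfolding b_def by auto
  have r: "r + t * ?d \<ge> 0"
    using t scale[OF kollar_degree_pos[OF a']] by linarith
  have "int (a' i) * b i + b (i + 1)
      = (if i = j then int (a i) else 0) + (if i + 1 = j then 1 else 0) + (r + t * ?d)" for i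
  proof -
    have "?d = int (a' i) * ?w i + ?w (i + 1)"
      using kollar_weight_cyclic[OF a', of i] by (metis of_nat_add of_nat_mult)
    then show ?thesis
      using c[of i] by (simp add: b_def algebra_simps split: if_splits)
  qed
  then have "int (a' i * nat (b i) + nat (b (i + 1)))
      = int ((if i = j then a i else 0) + (if i + 1 = j then 1 else 0) + nat (r + t * ?d))" for i
    using b r by simp
  then show ?thesis
    unfolding of_nat_eq_iff by (intro exI[of _ "\<lambda>i. nat (b i)"] exI[of _ "nat (r + t * ?d)"]) blast
qed

section \<open>Affine forms that avoid given primes\<close>

text \<open>The Chinese remainder theorem: conditions modulo finitely many primes that can be satisfied one
  prime at a time can be satisfied together, by arbitrarily large numbers.\<close>

lemma simultaneous_residue_choice:
  fixes M :: int
  assumes "M \<noteq> 0"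
    and Q: "\<And>p k l. \<lbrakk>Q p k; [k = l] (mod p)\<rbrakk> \<Longrightarrow> Q p l"
    and ex: "\<And>p. \<lbrakk>prime p; int p dvd M\<rbrakk> \<Longrightarrow> \<exists>k. Q p k"
  shows "\<exists>k \<ge> K. \<forall>p. prime p \<longrightarrow> int p dvd M \<longrightarrow> Q p (k :: nat)"
proof -
  define S where "S = {p. prime p \<and> int p dvd M}"
  have "S \<subseteq> {.. nat \<bar>M\<bar>}"
  proof
    fix p assume "p \<in> S"
    then have "\<bar>int p\<bar> \<le> \<bar>M\<bar>" unfolding S_def using dvd_imp_le_int[OF \<open>M \<noteq> 0\<close>] by blast
    then show "p \<in> {.. nat \<bar>M\<bar>}" by simp
  qed
  then have fin: "finite S" by (rule finite_subset) simp
  obtain u where u: "\<And>p. p \<in> S \<Longrightarrow> Q p (u p)"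
  proof -
    have "\<forall>p\<in>S. \<exists>k. Q p k" using ex by (simp add: S_def)
    then show ?thesis using that by metis
  qed
  have cop: "\<forall>i\<in>S. \<forall>j\<in>S. i \<noteq> j \<longrightarrow> coprime (id i) (id j)"
    by (auto simp: S_def intro: primes_coprime)
  obtain x where x: "\<And>p. p \<in> S \<Longrightarrow> [x = u p] (mod p)"
    using chinese_remainder_nat[OF fin cop, of u] by auto
  define k where "k = x + K * \<Prod>S"
  have pos: "\<Prod>S > 0"
    by (rule prod_pos) (auto simp: S_def prime_gt_0_nat)
  have "Q p k" if "p \<in> S" for p
  proof -
    have "p dvd K * \<Prod>S" using dvd_prodI[OF fin that, of "\<lambda>p. p"] by simp
    then have "[k = x] (mod p)" unfolding k_def cong_def by auto
    then have "[u p = k] (mod p)" using x[OF that] by (metis cong_sym cong_trans)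
    then show ?thesis using Q u that by blast
  qed
  moreover have "k \<ge> K" using pos by (simp add: k_def trans_le_add2)
  ultimately show ?thesis unfolding S_def by blast
qed

lemma affine_dvd_cong:
  fixes u c :: int
  assumes "[k = l] (mod p)"
  shows "int p dvd u * int k + c \<longleftrightarrow> int p dvd u * int l + c"
proof -
  have "[int k = int l] (mod int p)" using assms by (simp add: cong_int_iff)
  then have "[u * int k + c = u * int l + c] (mod int p)"
    by (intro cong_add cong_mult cong_refl)
  then show ?thesis by (rule cong_dvd_iff)
qed

text \<open>An affine form that does not vanish identically modulo \<open>p\<close> has at most one root modulo \<open>p\<close>, so it
  does not vanish at both 0 and 1.\<close>

lemma affine_avoid_primes:
  fixes M u c :: int
  assumes "M \<noteq> 0"
    and "\<And>p. \<lbrakk>prime p; int p dvd M; int p dvd u\<rbrakk> \<Longrightarrow> \<not> int p dvd c"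
  shows "\<exists>k \<ge> K. \<forall>p. prime p \<longrightarrow> int p dvd M \<longrightarrow> \<not> int p dvd u * int k + c"
proof (rule simultaneous_residue_choice[OF \<open>M \<noteq> 0\<close>])
  fix p :: nat assume p: "prime p" "int p dvd M"
  have "\<not> int p dvd u * int 0 + c \<or> \<not> int p dvd u * int 1 + c"
  proof (rule ccontr)
    assume "\<not> ?thesis"
    then have "int p dvd c" "int p dvd u" by (auto simp: dvd_add_left_iff)
    then show False using assms(2) p by blast
  qed
  then show "\<exists>k. \<not> int p dvd u * int k + c" by blast
qed (use affine_dvd_cong in blast)

lemma int_prime_dvd_mult:
  fixes x y :: int
  assumes "prime p" "int p dvd x * y"
  shows "int p dvd x \<or> int p dvd y"
proof -
  have "prime (int p)" using assms(1) by simp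
  then show ?thesis using assms(2) by (simp add: prime_dvd_mult_iff)
qed

text \<open>Two such forms together have at most two roots modulo \<open>p\<close>. This leaves a residue free as soon
  as \<open>p \<ge> 3\<close>; that is why the second form is only considered at divisors of the odd number \<open>m\<close>.\<close>

lemma two_affine_avoid_primes:
  fixes M m u c u' c' :: int
  assumes "M \<noteq> 0" and "odd m"
    and 1: "\<And>p. \<lbrakk>prime p; int p dvd M; int p dvd u\<rbrakk> \<Longrightarrow> \<not> int p dvd c"
    and 2: "\<And>p. \<lbrakk>prime p; int p dvd m; int p dvd u'\<rbrakk> \<Longrightarrow> \<not> int p dvd c'"
  shows "\<exists>k \<ge> K. \<forall>p. prime p \<longrightarrow> int p dvd M \<longrightarrow>
    \<not> int p dvd u * int k + c \<and> (int p dvd m \<longrightarrow> \<not> int p dvd u' * int k + c')"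
proof (rule simultaneous_residue_choice[OF \<open>M \<noteq> 0\<close>])
  fix p :: nat assume p: "prime p" "int p dvd M"
  have uniq: "int p dvd a \<and> int p dvd b"
    if "int p dvd m" "int p dvd a * int k + b" "int p dvd a * int l + b" "k < l" "l < 3"
    for a b :: int and k l
  proof -
    have "p \<noteq> 2" using that(1) \<open>odd m\<close> by auto
    then have "p > 2" using prime_ge_2_nat[OF p(1)] by linarith
    then have "\<not> p dvd l - k" using that(4,5) by (auto dest!: dvd_imp_le)
    then have "\<not> int p dvd int (l - k)" by (simp only: int_dvd_int_iff not_False_eq_True)
    moreover have "int p dvd a * int (l - k)"
      using dvd_diff[OF that(3,2)] that(4) by (simp add: algebra_simps)
    ultimately have "int p dvd a" using int_prime_dvd_mult[OF p(1)] by blast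
    then show ?thesis using that(2) by (auto simp: dvd_add_right_iff)
  qed
  show "\<exists>k. \<not> int p dvd u * int k + c \<and> (int p dvd m \<longrightarrow> \<not> int p dvd u' * int k + c')"
  proof (cases "int p dvd m")
    case True
    show ?thesis
    proof (rule ccontr)
      assume "\<not> ?thesis"
      then have bad: "int p dvd u * int k + c \<or> int p dvd u' * int k + c'" for k by blast
      have "\<And>k l. k < l \<Longrightarrow> l < 3 \<Longrightarrow> \<not> (int p dvd u * int k + c \<and> int p dvd u * int l + c)"
        "\<And>k l. k < l \<Longrightarrow> l < 3 \<Longrightarrow> \<not> (int p dvd u' * int k + c' \<and> int p dvd u' * int l + c')"
        using uniq[OF True] 1[OF p] 2[OF p(1) True] by blast+
      from this[of 0 1] this[of 1 2] this[of 0 2] show False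
        using bad[of 0] bad[of 1] bad[of 2] by auto
    qed
  next
    case False
    have "\<not> int p dvd u * int 0 + c \<or> \<not> int p dvd u * int 1 + c"
    proof (rule ccontr)
      assume "\<not> ?thesis"
      then have "int p dvd c" "int p dvd u" by (auto simp: dvd_add_left_iff)
      then show False using 1 p by blast
    qed
    then show ?thesis using False by blast
  qed
qed (use affine_dvd_cong in blast)

lemma coprime_if_no_common_prime:
  fixes x y :: int
  assumes "\<And>p. prime p \<Longrightarrow> int p dvd x \<Longrightarrow> int p dvd y \<Longrightarrow> False"
  shows "gcd x y = 1"
proof (rule ccontr)
  assume "gcd x y \<noteq> 1"
  then have "nat (gcd x y) \<noteq> 1" by (simp add: nat_eq_iff)
  then obtain p where "prime p" "p dvd nat (gcd x y)" using prime_factor_nat by blast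
  then have "int p dvd gcd x y" by (simp flip: int_dvd_int_iff)
  then show False using assms \<open>prime p\<close> by auto
qed

lemma no_prime_divides_both:
  fixes x y r t :: int
  assumes "prime p" "int p dvd x" "int p dvd y" "r * x - t * y = 1"
  shows False
proof -
  have "int p dvd r * x - t * y" using assms(2,3) by (intro dvd_diff dvd_mult)
  then show False using assms(1,4) by simp
qed

section \<open>The choice of the congruent tuple\<close>

text \<open>In terms of \<open>W\<^sub>1\<close>, ..., \<open>W\<^sub>4\<close> for the tuple \<open>(a1, a2, a3, a4)\<close>, the last two conclusions say
  \<open>gcd(W\<^sub>1, W\<^sub>3) = gcd(W\<^sub>2, W\<^sub>4) = N\<close>. The entries are chosen in the order \<open>a2\<close>, \<open>a3\<close>, \<open>a1\<close>, \<open>a4\<close>.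
  Once the first three are fixed, \<open>W\<^sub>4 = N m\<close> is a constant and \<open>W\<^sub>1\<close>, \<open>W\<^sub>2\<close>, \<open>W\<^sub>3\<close> are affine
  in \<open>a4\<close>. The resultant of \<open>W\<^sub>1\<close> and \<open>W\<^sub>3\<close> with respect to \<open>a4\<close> is \<open>(a2 - 1) W\<^sub>4\<close> up to sign, so
  it suffices that \<open>W\<^sub>1 / N\<close> avoids the primes dividing \<open>(a2 - 1) m\<close> and that \<open>W\<^sub>2 / N\<close> avoids those
  dividing \<open>m\<close>. The first form never vanishes identically modulo a prime, because
  \<open>W\<^sub>1 + 1\<close> is a multiple of its leading coefficient. The second one can vanish identically only
  modulo a prime that divides \<open>a3 - 1\<close>. Hence the choice of \<open>a1\<close> must make \<open>m\<close> coprime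
  to \<open>2 (a3 - 1)\<close>, and for this in turn \<open>a3 - 1\<close> must be coprime to \<open>a2\<close>.\<close>

lemma congruent_numbers_with_prescribed_gcds:
  fixes N \<alpha>1 \<alpha>2 \<alpha>3 \<alpha>4 :: int
  assumes N: "N > 0" and pos: "\<alpha>1 > 0" "\<alpha>2 > 0" "\<alpha>3 > 0" "\<alpha>4 > 0"
    and W1: "N dvd \<alpha>2 * \<alpha>3 * \<alpha>4 - \<alpha>3 * \<alpha>4 + \<alpha>4 - 1"
    and W2: "N dvd \<alpha>3 * \<alpha>4 * \<alpha>1 - \<alpha>4 * \<alpha>1 + \<alpha>1 - 1"
    and W3: "N dvd \<alpha>4 * \<alpha>1 * \<alpha>2 - \<alpha>1 * \<alpha>2 + \<alpha>2 - 1"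
    and W4: "N dvd \<alpha>1 * \<alpha>2 * \<alpha>3 - \<alpha>2 * \<alpha>3 + \<alpha>3 - 1"
  obtains k1 k2 k3 k4 :: nat and a1 a2 a3 a4 :: int
  where "k1 > 0" "k2 > 0" "k3 > 0" "k4 > K"
    and "a1 = \<alpha>1 + N * int k1" "a2 = \<alpha>2 + N * int k2"
      "a3 = \<alpha>3 + N * int k3" "a4 = \<alpha>4 + N * int k4"
    and "gcd (a2 * a3 * a4 - a3 * a4 + a4 - 1) (a4 * a1 * a2 - a1 * a2 + a2 - 1) = N"
    and "gcd (a3 * a4 * a1 - a4 * a1 + a1 - 1) (a1 * a2 * a3 - a2 * a3 + a3 - 1) = N"
proof -
  \<comment> \<open>Adding \<open>N\<close> makes \<open>a2 - 1\<close> positive, hence the resultant nonzero.\<close>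
  define a2 where "a2 = \<alpha>2 + N"
  have a2: "a2 > 1" using N pos by (simp add: a2_def)
  \<comment> \<open>\<open>W\<^sub>3\<close> is a multiple of \<open>\<alpha>2\<close> minus 1, and it is divisible by \<open>N\<close>.\<close>
  have copN: "\<not> int p dvd N" if "prime p" "int p dvd a2" for p
  proof
    assume *: "int p dvd N"
    then have "int p dvd \<alpha>2" using that(2) by (simp add: a2_def dvd_add_left_iff)
    moreover have "int p dvd \<alpha>4 * \<alpha>1 * \<alpha>2 - \<alpha>1 * \<alpha>2 + \<alpha>2 - 1"
      using W3 * by (rule dvd_trans[rotated])
    moreover have "(\<alpha>4 * \<alpha>1 - \<alpha>1 + 1) * \<alpha>2 - 1 * (\<alpha>4 * \<alpha>1 * \<alpha>2 - \<alpha>1 * \<alpha>2 + \<alpha>2 - 1) = 1"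
      by algebra
    ultimately show False using no_prime_divides_both[OF that(1)] by blast
  qed
  obtain k3 where k3: "k3 \<ge> 1" "\<And>p. prime p \<Longrightarrow> int p dvd a2 \<Longrightarrow> \<not> int p dvd N * int k3 + (\<alpha>3 - 1)"
    using affine_avoid_primes[of a2 N "\<alpha>3 - 1" 1] a2 copN by auto
  define a3 where "a3 = \<alpha>3 + N * int k3"
  have "N * int k3 > 0" using N k3(1) by simp
  then have a3: "a3 > 1" using pos unfolding a3_def by linarith
  have k3': "\<not> int p dvd a3 - 1" if "prime p" "int p dvd a2" for p
    using k3(2)[OF that] by (simp add: a3_def algebra_simps)
  have c23: "[a2 = \<alpha>2] (mod N)" "[a3 = \<alpha>3] (mod N)"
    by (simp_all add: a2_def a3_def cong_def)
  have "[\<alpha>1 * a2 * a3 - a2 * a3 + a3 - 1 = \<alpha>1 * \<alpha>2 * \<alpha>3 - \<alpha>2 * \<alpha>3 + \<alpha>3 - 1] (mod N)"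
    by (intro cong_add cong_diff cong_mult cong_refl c23)
  then have "N dvd \<alpha>1 * a2 * a3 - a2 * a3 + a3 - 1" using W4 by (simp add: cong_dvd_iff)
  \<comment> \<open>With \<open>a1 = \<alpha>1 + N k\<close>, the quotient \<open>W\<^sub>4 / N\<close> is \<open>a2 a3 k + c\<close>.\<close>
  then obtain c where c: "\<alpha>1 * a2 * a3 - a2 * a3 + a3 - 1 = N * c" by blast
  have "\<exists>k \<ge> 1. \<forall>p. prime p \<longrightarrow> int p dvd 2 * (a3 - 1) \<longrightarrow> \<not> int p dvd a2 * a3 * int k + c"
  proof (rule affine_avoid_primes)
    show "2 * (a3 - 1) \<noteq> 0" using a3 by simp
    fix p assume p: "prime p" "int p dvd 2 * (a3 - 1)" "int p dvd a2 * a3"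
    have *: "int p dvd a3"
    proof (rule ccontr)
      assume "\<not> int p dvd a3"
      then have "int p dvd a2" using int_prime_dvd_mult[OF p(1,3)] by blast
      then have "\<not> int p dvd a3 - 1" using k3' p(1) by blast
      then have "int p dvd 2" using int_prime_dvd_mult[OF p(1,2)] by blast
      then have "p = 2" using primes_dvd_imp_eq[OF p(1) two_is_prime_nat] int_dvd_int_iff[of p 2] by simp
      then show False using \<open>\<not> int p dvd a3\<close> \<open>\<not> int p dvd a3 - 1\<close> by simp
    qed
    show "\<not> int p dvd c"
    proof
      assume "int p dvd c"
      moreover have "(\<alpha>1 * a2 - a2 + 1) * a3 - N * c = 1" unfolding c[symmetric] by algebra
      ultimately show False using no_prime_divides_both[OF p(1) *] by blast
    qed
  qed
  then obtain k1 where k1: "k1 \<ge> 1" "\<And>p. prime p \<Longrightarrow> int p dvd 2 * (a3 - 1) \<Longrightarrow> \<not> int p dvd a2 * a3 * int k1 + c"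
    by blast
  define a1 where "a1 = \<alpha>1 + N * int k1"
  define m where "m = a2 * a3 * int k1 + c"
  have "N * int k1 > 0" using N k1(1) by simp
  then have a1: "a1 > 1" using pos unfolding a1_def by linarith
  have m: "a1 * a2 * a3 - a2 * a3 + a3 - 1 = N * m"
    using c by (simp add: m_def a1_def algebra_simps)
  have "a1 * a2 * a3 - a2 * a3 + a3 - 1 = (a1 - 1) * a2 * a3 + (a3 - 1)" by algebra
  also have "\<dots> > 0" using a1 a2 a3 by (intro add_nonneg_pos mult_nonneg_nonneg) auto
  finally have "m \<noteq> 0" using m by auto
  have "odd m" using k1(2)[of 2] by (simp add: m_def)
  have c1: "[a1 = \<alpha>1] (mod N)" by (simp add: a1_def cong_def)
  have "[a2 * a3 * \<alpha>4 - a3 * \<alpha>4 + \<alpha>4 - 1 = \<alpha>2 * \<alpha>3 * \<alpha>4 - \<alpha>3 * \<alpha>4 + \<alpha>4 - 1] (mod N)"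
    "[a3 * \<alpha>4 * a1 - \<alpha>4 * a1 + a1 - 1 = \<alpha>3 * \<alpha>4 * \<alpha>1 - \<alpha>4 * \<alpha>1 + \<alpha>1 - 1] (mod N)"
    "[\<alpha>4 * a1 * a2 - a1 * a2 + a2 - 1 = \<alpha>4 * \<alpha>1 * \<alpha>2 - \<alpha>1 * \<alpha>2 + \<alpha>2 - 1] (mod N)"
    by (intro cong_add cong_diff cong_mult cong_refl c23 c1)+
  then have "N dvd a2 * a3 * \<alpha>4 - a3 * \<alpha>4 + \<alpha>4 - 1" "N dvd a3 * \<alpha>4 * a1 - \<alpha>4 * a1 + a1 - 1"
    "N dvd \<alpha>4 * a1 * a2 - a1 * a2 + a2 - 1"
    using W1 W2 W3 by (simp_all add: cong_dvd_iff)
  \<comment> \<open>The constant terms of \<open>W\<^sub>1 / N\<close>, \<open>W\<^sub>2 / N\<close>, \<open>W\<^sub>3 / N\<close> as affine forms in \<open>k\<close>, where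
      \<open>a4 = \<alpha>4 + N k\<close>.\<close>
  then obtain d1 d2 d3 where d: "a2 * a3 * \<alpha>4 - a3 * \<alpha>4 + \<alpha>4 - 1 = N * d1"
    "a3 * \<alpha>4 * a1 - \<alpha>4 * a1 + a1 - 1 = N * d2" "\<alpha>4 * a1 * a2 - a1 * a2 + a2 - 1 = N * d3"
    by (metis dvd_def)
  have "\<exists>k \<ge> K + 1. \<forall>p. prime p \<longrightarrow> int p dvd (a2 - 1) * m \<longrightarrow>
    \<not> int p dvd (a3 * (a2 - 1) + 1) * int k + d1 \<and> (int p dvd m \<longrightarrow> \<not> int p dvd (a1 * (a3 - 1)) * int k + d2)"
  proof (rule two_affine_avoid_primes)
    show "(a2 - 1) * m \<noteq> 0" using a2 \<open>m \<noteq> 0\<close> by simp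
    show "odd m" by fact
  next
    fix p assume p: "prime p" "int p dvd a3 * (a2 - 1) + 1"
    show "\<not> int p dvd d1"
    proof
      assume "int p dvd d1"
      moreover have "\<alpha>4 * (a3 * (a2 - 1) + 1) - N * d1 = 1" unfolding d[symmetric] by algebra
      ultimately show False using no_prime_divides_both[OF p(1) p(2)] by blast
    qed
  next
    fix p assume p: "prime p" "int p dvd m" "int p dvd a1 * (a3 - 1)"
    have "\<not> int p dvd a3 - 1" using k1(2)[OF p(1) dvd_mult] p(2) unfolding m_def by blast
    then have a1p: "int p dvd a1" using int_prime_dvd_mult[OF p(1,3)] by blast
    show "\<not> int p dvd d2"
    proof
      assume "int p dvd d2"
      moreover have "(a3 * \<alpha>4 - \<alpha>4 + 1) * a1 - N * d2 = 1" unfolding d[symmetric] by algebra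
      ultimately show False using no_prime_divides_both[OF p(1) a1p] by blast
    qed
  qed
  then obtain k4 where k4: "k4 \<ge> K + 1"
    and k4p: "\<And>p. prime p \<Longrightarrow> int p dvd (a2 - 1) * m \<Longrightarrow> \<not> int p dvd (a3 * (a2 - 1) + 1) * int k4 + d1"
      "\<And>p. prime p \<Longrightarrow> int p dvd m \<Longrightarrow> \<not> int p dvd (a1 * (a3 - 1)) * int k4 + d2"
    by (metis dvd_mult)
  define a4 where "a4 = \<alpha>4 + N * int k4"
  define w1 w2 w3 where "w1 = (a3 * (a2 - 1) + 1) * int k4 + d1"
    and "w2 = (a1 * (a3 - 1)) * int k4 + d2" and "w3 = a1 * a2 * int k4 + d3"
  have w: "a2 * a3 * a4 - a3 * a4 + a4 - 1 = N * w1" "a3 * a4 * a1 - a4 * a1 + a1 - 1 = N * w2"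
    "a4 * a1 * a2 - a1 * a2 + a2 - 1 = N * w3"
  proof -
    have "N * w1 = (a3 * (a2 - 1) + 1) * (N * int k4) + N * d1"
      "N * w2 = a1 * (a3 - 1) * (N * int k4) + N * d2"
      "N * w3 = a1 * a2 * (N * int k4) + N * d3"
      unfolding w1_def w2_def w3_def by (simp_all only: distrib_left mult.left_commute)
    then show "a2 * a3 * a4 - a3 * a4 + a4 - 1 = N * w1" "a3 * a4 * a1 - a4 * a1 + a1 - 1 = N * w2"
      "a4 * a1 * a2 - a1 * a2 + a2 - 1 = N * w3"
      unfolding d[symmetric] a4_def by (simp_all add: algebra_simps)
  qed
  have "N * (a1 * a2 * w1 - (a3 * (a2 - 1) + 1) * w3)
      = a1 * a2 * (N * w1) - (a3 * (a2 - 1) + 1) * (N * w3)"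
    by (simp only: right_diff_distrib mult.left_commute)
  also have "\<dots> = (a2 - 1) * (N * m)"
    unfolding w[symmetric] m[symmetric] by (simp add: algebra_simps)
  finally have "N * ((a2 - 1) * m) = N * (a1 * a2 * w1 - (a3 * (a2 - 1) + 1) * w3)"
    by (simp only: mult.left_commute)
  then have res: "(a2 - 1) * m = a1 * a2 * w1 - (a3 * (a2 - 1) + 1) * w3"
    using N by simp
  have "gcd w1 w3 = 1"
  proof (rule coprime_if_no_common_prime)
    fix p assume p: "prime p" "int p dvd w1" "int p dvd w3"
    then have "int p dvd (a2 - 1) * m" unfolding res by simp
    then show False using k4p(1) p unfolding w1_def by blast
  qed
  moreover have "gcd w2 m = 1"
    by (rule coprime_if_no_common_prime) (use k4p(2) in \<open>auto simp: w2_def\<close>)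
  ultimately have "gcd (N * w1) (N * w3) = N" "gcd (N * w2) (N * m) = N"
    using N by (simp_all add: gcd_mult_distrib_int[symmetric])
  then have "gcd (a2 * a3 * a4 - a3 * a4 + a4 - 1) (a4 * a1 * a2 - a1 * a2 + a2 - 1) = N"
      "gcd (a3 * a4 * a1 - a4 * a1 + a1 - 1) (a1 * a2 * a3 - a2 * a3 + a3 - 1) = N"
    by (simp_all only: w m)
  note gcds = this
  show thesis
    by (rule that[of k1 1 k3 k4, OF _ _ _ _ a1_def _ a3_def a4_def gcds])
      (use k1(1) k3(1) k4 in \<open>simp_all add: a2_def\<close>)
qed

section \<open>Orbits and the morphisms given by equivariant polynomial maps\<close>

text \<open>The same exponent vector may occur for several indices; collecting the coefficients yields the
  indexing by distinct exponents that the definition of \<open>whomog\<close> asks for.\<close>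

lemma whomog_sum_monomials:
  fixes h :: "'k \<Rightarrow> 'n::finite \<Rightarrow> nat"
  assumes "finite I" and "\<And>k. k \<in> I \<Longrightarrow> (\<Sum>i\<in>UNIV. w i * h k i) = d"
  shows "whomog w d (\<lambda>x. \<Sum>k\<in>I. c k * (\<Prod>i\<in>UNIV. x $ i ^ h k i))"
proof -
  define b where "b = (\<lambda>m. \<Sum>k\<in>{k \<in> I. h k = m}. c k)"
  have "(\<Sum>k\<in>I. c k * (\<Prod>i\<in>UNIV. x $ i ^ h k i)) = (\<Sum>m\<in>h ` I. b m * (\<Prod>i\<in>UNIV. x $ i ^ m i))"
    for x :: "complex ^ 'n"
  proof -
    have "(\<Sum>k\<in>I. c k * (\<Prod>i\<in>UNIV. x $ i ^ h k i))
        = (\<Sum>m\<in>h ` I. \<Sum>k\<in>{k \<in> I. h k = m}. c k * (\<Prod>i\<in>UNIV. x $ i ^ h k i))"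
      by (rule sum.image_gen[OF assms(1)])
    also have "\<dots> = (\<Sum>m\<in>h ` I. b m * (\<Prod>i\<in>UNIV. x $ i ^ m i))"
      by (rule sum.cong) (auto simp: b_def sum_distrib_right intro!: sum.cong)
    finally show ?thesis .
  qed
  moreover have "\<forall>m\<in>h ` I. (\<Sum>i\<in>UNIV. w i * m i) = d"
    using assms(2) by auto
  ultimately show ?thesis
    unfolding whomog_def using assms(1) by blast
qed

lemma self_in_worbit: "x \<in> worbit w x"
  unfolding worbit_def by (auto simp: wscale_def vec_eq_iff intro!: exI[of _ 1])

lemma worbit_wscale:
  assumes "t \<noteq> 0"
  shows "worbit w (wscale w t x) = worbit w x"
proof -
  have comp: "wscale w s (wscale w t x) = wscale w (s * t) x" for s
    by (simp add: wscale_def vec_eq_iff power_mult_distrib)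
  show ?thesis
  proof
    show "worbit w (wscale w t x) \<subseteq> worbit w x"
      using assms unfolding worbit_def comp by auto
    show "worbit w x \<subseteq> worbit w (wscale w t x)"
    proof
      fix y assume "y \<in> worbit w x"
      then obtain s where s: "s \<noteq> 0" "y = wscale w s x" by (auto simp: worbit_def)
      then have "y = wscale w (s / t) (wscale w t x)" unfolding comp using assms by simp
      then show "y \<in> worbit w (wscale w t x)"
        using s(1) assms unfolding worbit_def by (intro CollectI exI[of _ "s / t"]) simp
    qed
  qed
qed

lemma wproj_eq_worbit:
  assumes "p \<in> wproj w" "x \<in> p"
  shows "p = worbit w x"
proof -
  obtain y where y: "p = worbit w y" using assms(1) by (auto simp: wproj_def)
  then obtain t where "t \<noteq> 0" "x = wscale w t y" using assms(2) by (auto simp: worbit_def)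
  then show ?thesis using y worbit_wscale by metis
qed

lemma wproj_nonempty: "p \<in> wproj w \<Longrightarrow> \<exists>x. x \<in> p"
  using self_in_worbit by (auto simp: wproj_def)

text \<open>For an equivariant \<open>G\<close> all the orbits in the union coincide; the union avoids choosing a
  representative.\<close>

definition orbit_map :: "('m::finite \<Rightarrow> nat) \<Rightarrow> (complex ^ 'n \<Rightarrow> complex ^ 'm) \<Rightarrow>
    (complex ^ 'n::finite) set \<Rightarrow> (complex ^ 'm) set" where
  "orbit_map v G p = (\<Union>x\<in>p. worbit v (G x))"

lemma orbit_map_worbit:
  assumes G: "\<And>t x. t \<noteq> 0 \<Longrightarrow> \<exists>s. s \<noteq> 0 \<and> G (wscale w t x) = wscale v s (G x)"
  shows "orbit_map v G (worbit w x) = worbit v (G x)"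
proof -
  have "worbit v (G y) = worbit v (G x)" if y: "y \<in> worbit w x" for y
  proof -
    obtain t where "t \<noteq> 0" "y = wscale w t x" using y unfolding worbit_def by blast
    then show ?thesis using G worbit_wscale by metis
  qed
  then show ?thesis unfolding orbit_map_def using self_in_worbit[of x w] by blast
qed

text \<open>Pulling back along \<open>G\<close> turns homogeneous equations into homogeneous equations, and fractions of
  equal degree into fractions of equal degree. The factor \<open>\<mu>\<close> is the same for numerator and
  denominator, which is what makes regular functions pull back to regular functions.\<close>

lemma variety_morphism_orbit_map:
  fixes G :: "complex ^ 'n::finite \<Rightarrow> complex ^ 'm::finite"
  assumes G: "\<And>t x. t \<noteq> 0 \<Longrightarrow> \<exists>s. s \<noteq> 0 \<and> G (wscale w t x) = wscale v s (G x)"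
    and pull: "\<And>d f. whomog v d f \<Longrightarrow> whomog w (\<mu> * d) (\<lambda>x. f (G x))"
    and U: "U \<subseteq> wproj w" and V: "V \<subseteq> wproj v"
    and maps: "\<And>p. p \<in> U \<Longrightarrow> orbit_map v G p \<in> V"
  shows "variety_morphism w U v V (orbit_map v G)"
proof -
  let ?\<phi> = "orbit_map v G"
  have G_in: "G x \<in> ?\<phi> p" if "x \<in> p" for x p
    using that self_in_worbit[of "G x" v] by (auto simp: orbit_map_def)
  have zeros: "(\<forall>y\<in>?\<phi> p. f y = 0) \<longleftrightarrow> (\<forall>x\<in>p. f (G x) = 0)" if p: "p \<in> U" and f: "whomog v d f" for p d f
  proof
    assume "\<forall>x\<in>p. f (G x) = 0"
    then show "\<forall>y\<in>?\<phi> p. f y = 0"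
      using whomog_scale[OF f] by (auto simp: orbit_map_def worbit_def)
  qed (use G_in in blast)
  have pre: "\<exists>T'. openin (zariski w) T' \<and> {p \<in> U. ?\<phi> p \<in> T} = T' \<inter> U"
    if T: "openin (zariski v) T" for T
  proof -
    obtain S where S: "\<And>f. f \<in> S \<Longrightarrow> \<exists>d. whomog v d f" and T: "T = wproj v - wzeros v S"
      using T unfolding openin_zariski wclosed_def by blast
    define S' where "S' = (\<lambda>f x. f (G x)) ` S"
    have "\<forall>f\<in>S'. \<exists>d. whomog w d f"
      using S pull unfolding S'_def by blast
    then have "openin (zariski w) (wproj w - wzeros w S')"
      unfolding openin_zariski wclosed_def by blast
    moreover have "?\<phi> p \<in> wzeros v S \<longleftrightarrow> p \<in> wzeros w S'" if p: "p \<in> U" for p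
    proof -
      have "?\<phi> p \<in> wzeros v S \<longleftrightarrow> (\<forall>f\<in>S. \<forall>y\<in>?\<phi> p. f y = 0)"
        using maps[OF p] V by (auto simp: wzeros_def)
      also have "\<dots> \<longleftrightarrow> (\<forall>f\<in>S. \<forall>x\<in>p. f (G x) = 0)"
        using zeros[OF p] S by meson
      also have "\<dots> \<longleftrightarrow> p \<in> wzeros w S'"
        using p U by (auto simp: wzeros_def S'_def)
      finally show ?thesis .
    qed
    then have "{p \<in> U. ?\<phi> p \<in> T} = (wproj w - wzeros w S') \<inter> U"
      using U V maps by (auto simp: T)
    ultimately show ?thesis by blast
  qed
  have top: "topspace (subtopology (zariski w) U) = U" "topspace (subtopology (zariski v) V) = V"
    using U V by (auto simp: topspace_zariski)
  have cont: "continuous_map (subtopology (zariski w) U) (subtopology (zariski v) V) ?\<phi>"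
    unfolding continuous_map top
  proof (intro conjI allI impI)
    show "?\<phi> ` U \<subseteq> V" using maps by blast
    fix T assume "openin (subtopology (zariski v) V) T"
    then obtain T1 where T1: "openin (zariski v) T1" "T = T1 \<inter> V"
      unfolding openin_subtopology by blast
    then have "{p \<in> U. ?\<phi> p \<in> T} = {p \<in> U. ?\<phi> p \<in> T1}" using maps by blast
    then show "openin (subtopology (zariski w) U) {p \<in> U. ?\<phi> p \<in> T}"
      using pre[OF T1(1)] unfolding openin_subtopology by auto
  qed
  have reg: "regular_on w {p \<in> U. ?\<phi> p \<in> N} (f \<circ> ?\<phi>)"
    if N: "openin (subtopology (zariski v) V) N" and f: "regular_on v N f" for N f
    unfolding regular_on_def
  proof
    fix p assume p: "p \<in> {p \<in> U. ?\<phi> p \<in> N}"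
    then have \<phi>p: "?\<phi> p \<in> N" by simp
    obtain N1 d g h where N1: "openin (subtopology (zariski v) N) N1" "?\<phi> p \<in> N1"
      and gh: "whomog v d g" "whomog v d h" "\<forall>q\<in>N1. \<forall>x\<in>q. h x \<noteq> 0 \<and> f q = g x / h x"
      using bspec[OF f[unfolded regular_on_def] \<phi>p] by (elim exE conjE) (rule that)
    obtain T where T: "openin (zariski v) T" "N1 = T \<inter> N"
      using N1(1) unfolding openin_subtopology by blast
    obtain T' where T': "openin (zariski w) T'" "{p \<in> U. ?\<phi> p \<in> T} = T' \<inter> U"
      using pre[OF T(1)] by blast
    define P where "P = {q \<in> U. ?\<phi> q \<in> N1}"
    have "P = T' \<inter> {p \<in> U. ?\<phi> p \<in> N}"
      using T' unfolding P_def T by blast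
    then have "openin (subtopology (zariski w) {p \<in> U. ?\<phi> p \<in> N}) P"
      using T'(1) unfolding openin_subtopology by blast
    moreover have "p \<in> P" using p N1(2) by (simp add: P_def)
    moreover have "\<forall>q\<in>P. \<forall>x\<in>q. h (G x) \<noteq> 0 \<and> (f \<circ> ?\<phi>) q = g (G x) / h (G x)"
      using gh(3) G_in by (auto simp: P_def)
    ultimately show "\<exists>N' d g h. openin (subtopology (zariski w) {p \<in> U. ?\<phi> p \<in> N}) N' \<and> p \<in> N' \<and>
      whomog w d g \<and> whomog w d h \<and> (\<forall>q\<in>N'. \<forall>x\<in>q. h x \<noteq> 0 \<and> (f \<circ> ?\<phi>) q = g x / h x)"
      by (intro exI[of _ P] exI[of _ "\<mu> * d"] exI[of _ "\<lambda>x. g (G x)"] exI[of _ "\<lambda>x. h (G x)"] conjI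
        pull gh)
  qed
  show ?thesis
    unfolding variety_morphism_def using cont reg by blast
qed

section \<open>Monomial maps\<close>

definition monomial_map :: "('m \<Rightarrow> 'n \<Rightarrow> nat) \<Rightarrow> complex ^ 'n::finite \<Rightarrow> complex ^ 'm::finite" where
  "monomial_map B x = (\<chi> i. \<Prod>j\<in>UNIV. x $ j ^ B i j)"

lemma prod_power_prod:
  fixes x :: "'j \<Rightarrow> 'a::comm_semiring_1"
  shows "(\<Prod>i\<in>I. (\<Prod>j\<in>J. x j ^ B i j) ^ m i) = (\<Prod>j\<in>J. x j ^ (\<Sum>i\<in>I. m i * B i j))"
proof -
  have "(x j ^ B i j) ^ m i = x j ^ (m i * B i j)" for i j
    by (simp add: mult.commute flip: power_mult)
  then have "(\<Prod>i\<in>I. (\<Prod>j\<in>J. x j ^ B i j) ^ m i) = (\<Prod>i\<in>I. \<Prod>j\<in>J. x j ^ (m i * B i j))"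
    by (simp add: prod_power_distrib)
  also have "\<dots> = (\<Prod>j\<in>J. \<Prod>i\<in>I. x j ^ (m i * B i j))"
    by (rule prod.swap)
  finally show ?thesis by (simp add: power_sum)
qed

lemma monomial_map_comp:
  "monomial_map C (monomial_map B x) = monomial_map (\<lambda>i k. \<Sum>j\<in>UNIV. C i j * B j k) x"
  by (simp add: monomial_map_def vec_eq_iff prod_power_prod)

lemma monomial_map_wscale:
  assumes "\<And>i. (\<Sum>j\<in>UNIV. B i j * w j) = \<mu> * v i"
  shows "monomial_map B (wscale w t x) = wscale v (t ^ \<mu>) (monomial_map B x)"
proof -
  have "(\<Prod>j\<in>UNIV. (t ^ w j * x $ j) ^ B i j) = (t ^ \<mu>) ^ v i * (\<Prod>j\<in>UNIV. x $ j ^ B i j)" for i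
    by (simp add: power_mult_distrib prod.distrib assms mult.commute[of "w _"] flip: power_mult power_sum)
  then show ?thesis by (simp add: monomial_map_def wscale_def vec_eq_iff)
qed

text \<open>Here it matters that the exponents are natural numbers: the pullback of a polynomial is again a
  polynomial, not just a Laurent polynomial.\<close>

lemma whomog_monomial_map:
  assumes B: "\<And>i. (\<Sum>j\<in>UNIV. B i j * w j) = \<mu> * v i" and f: "whomog v d f"
  shows "whomog w (\<mu> * d) (\<lambda>x. f (monomial_map B x))"
proof -
  obtain M c where M: "finite M" "\<And>m. m \<in> M \<Longrightarrow> (\<Sum>i\<in>UNIV. v i * m i) = d"
    and f: "f = (\<lambda>x. \<Sum>m\<in>M. c m * (\<Prod>i\<in>UNIV. x $ i ^ m i))"
    using f by (auto simp: whomog_def)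
  have "whomog w (\<mu> * d) (\<lambda>x. \<Sum>m\<in>M. c m * (\<Prod>j\<in>UNIV. x $ j ^ (\<Sum>i\<in>UNIV. m i * B i j)))"
  proof (rule whomog_sum_monomials[OF M(1)])
    fix m assume m: "m \<in> M"
    have "(\<Sum>j\<in>UNIV. w j * (\<Sum>i\<in>UNIV. m i * B i j)) = (\<Sum>j\<in>UNIV. \<Sum>i\<in>UNIV. m i * (B i j * w j))"
      by (simp add: sum_distrib_left mult_ac)
    also have "\<dots> = (\<Sum>i\<in>UNIV. \<Sum>j\<in>UNIV. m i * (B i j * w j))"
      by (rule sum.swap)
    also have "\<dots> = (\<Sum>i\<in>UNIV. m i * (\<mu> * v i))"
      by (simp add: B flip: sum_distrib_left)
    also have "\<dots> = \<mu> * (\<Sum>i\<in>UNIV. v i * m i)"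
      by (simp add: sum_distrib_left mult_ac)
    finally show "(\<Sum>j\<in>UNIV. w j * (\<Sum>i\<in>UNIV. m i * B i j)) = \<mu> * d"
      using M(2)[OF m] by simp
  qed
  then show ?thesis unfolding f by (simp add: monomial_map_def prod_power_prod)
qed

section \<open>Isomorphisms between the tori of Kollar surfaces\<close>

definition kollar_exponent :: "(4 \<Rightarrow> nat) \<Rightarrow> 4 \<Rightarrow> 4 \<Rightarrow> nat" where
  "kollar_exponent a i j = (if i = j then a i else 0) + (if i + 1 = j then 1 else 0)"

lemma prod_kollar_exponent:
  fixes x :: "4 \<Rightarrow> 'a::comm_monoid_mult"
  shows "(\<Prod>j\<in>UNIV. x j ^ kollar_exponent a i j) = x i ^ a i * x (i + 1)"
proof -
  have "(\<Prod>j\<in>UNIV. x j ^ kollar_exponent a i j)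
      = (\<Prod>j\<in>UNIV. if i = j then x j ^ a j else 1) * (\<Prod>j\<in>UNIV. if i + 1 = j then x j else 1)"
    unfolding prod.distrib[symmetric]
    by (rule prod.cong) (auto simp: kollar_exponent_def)
  then show ?thesis by simp
qed

lemma sum_kollar_exponent:
  fixes f :: "4 \<Rightarrow> nat"
  shows "(\<Sum>j\<in>UNIV. kollar_exponent a i j * f j) = a i * f i + f (i + 1)"
proof -
  have "(\<Sum>j\<in>UNIV. kollar_exponent a i j * f j)
      = (\<Sum>j\<in>UNIV. if i = j then a j * f j else 0) + (\<Sum>j\<in>UNIV. if i + 1 = j then f j else 0)"
    unfolding sum.distrib[symmetric]
    by (rule sum.cong) (auto simp: kollar_exponent_def)
  then show ?thesis by simp
qed

lemma kollar_poly_exponent: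
  "kollar_poly a x = (\<Sum>i\<in>UNIV. \<Prod>j\<in>UNIV. x $ j ^ kollar_exponent a i j)"
  by (simp add: kollar_poly_def prod_kollar_exponent)

lemma whomog_kollar_poly:
  assumes "kollar_tuple a"
  shows "whomog (kollar_weight a) (kollar_degree a) (kollar_poly a)"
proof -
  have "whomog (kollar_weight a) (kollar_degree a)
      (\<lambda>x. \<Sum>i\<in>UNIV. 1 * (\<Prod>j\<in>UNIV. x $ j ^ kollar_exponent a i j))"
    by (rule whomog_sum_monomials)
      (simp_all add: mult.commute[of "kollar_weight a _"] sum_kollar_exponent kollar_weight_cyclic[OF assms])
  then show ?thesis unfolding kollar_poly_exponent[abs_def] by simp
qed

text \<open>In matrix form \<open>A' B = A + (1, ..., 1)\<^sup>T r\<close>, where \<open>A\<close> and \<open>A'\<close> are the exponent matrices of the two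
  equations: substituting the monomial map with exponents \<open>B\<close> into each monomial of the second
  equation gives the corresponding monomial of the first one times the common factor \<open>x\<^sup>r\<close>.\<close>

definition kollar_transfer ::
    "(4 \<Rightarrow> nat) \<Rightarrow> (4 \<Rightarrow> nat) \<Rightarrow> (4 \<Rightarrow> 4 \<Rightarrow> nat) \<Rightarrow> (4 \<Rightarrow> nat) \<Rightarrow> bool" where
  "kollar_transfer a a' B r \<longleftrightarrow>
    (\<forall>i j. a' i * B i j + B (i + 1) j = kollar_exponent a i j + r j)"

lemma kollar_transfer_exists:
  assumes "kollar_tuple a'" and "\<And>j. int (kollar_wstar a') dvd int (a j) - int (a' j)"
  shows "\<exists>B r. kollar_transfer a a' B r"
proof -
  have "\<forall>j. \<exists>b r. \<forall>i. a' i * b i + b (i + 1) = kollar_exponent a i j + r"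
    using exponent_column_exists[OF assms(1)] assms(2) unfolding kollar_exponent_def by blast
  then obtain b r where "\<And>i j. a' i * b j i + b j (i + 1) = kollar_exponent a i j + r j"
    by metis
  then show ?thesis
    unfolding kollar_transfer_def by (intro exI[of _ "\<lambda>i j. b j i"] exI[of _ r]) blast
qed

text \<open>\<open>A' (B w) = A w + (r \<bullet> w) (1, ..., 1)\<^sup>T\<close> is constant since \<open>A w\<close> is, so \<open>B w\<close> is a multiple of \<open>w'\<close>.\<close>

lemma kollar_transfer_weight:
  assumes a: "kollar_tuple a" "kollar_tuple a'" and B: "kollar_transfer a a' B r"
  shows "\<exists>\<mu>. \<forall>i. (\<Sum>j\<in>UNIV. B i j * kollar_weight a j) = \<mu> * kollar_weight a' i"
proof -
  define v where "v = (\<lambda>i. \<Sum>j\<in>UNIV. B i j * kollar_weight a j)"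
  have "a' i * v i + v (i + 1) = kollar_degree a + (\<Sum>j\<in>UNIV. r j * kollar_weight a j)" for i
  proof -
    have "a' i * v i + v (i + 1) = (\<Sum>j\<in>UNIV. (a' i * B i j + B (i + 1) j) * kollar_weight a j)"
      by (simp add: v_def sum_distrib_left sum.distrib distrib_right mult.assoc)
    also have "\<dots> = (\<Sum>j\<in>UNIV. kollar_exponent a i j * kollar_weight a j) + (\<Sum>j\<in>UNIV. r j * kollar_weight a j)"
      using B by (simp add: kollar_transfer_def distrib_right sum.distrib)
    finally show ?thesis by (simp add: sum_kollar_exponent kollar_weight_cyclic[OF a(1)])
  qed
  then have "int (a' i) * int (v i) + int (v (i + 1))
      = int (kollar_degree a + (\<Sum>j\<in>UNIV. r j * kollar_weight a j))" for i
    by (metis of_nat_add of_nat_mult)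
  from cyclic_system_solution[OF a(2), of "\<lambda>i. int (v i)", OF this]
  obtain \<sigma> where \<sigma>: "\<And>i. int (v i) = \<sigma> * int (kollar_weight a' i)" by blast
  have "\<sigma> * int (kollar_weight a' 1) \<ge> 0" using \<sigma>[of 1] by (metis of_nat_0_le_iff)
  then have "\<sigma> \<ge> 0" using kollar_weight_pos[OF a(2), of 1] by (simp add: zero_le_mult_iff)
  then have "int (v i) = int (nat \<sigma> * kollar_weight a' i)" for i using \<sigma> by simp
  then show ?thesis unfolding of_nat_eq_iff v_def by blast
qed

text \<open>\<open>A C B = (A' + (1, ..., 1)\<^sup>T s) B = A + (1, ..., 1)\<^sup>T (r + s B)\<close>, so \<open>A\<close> maps every column of
  \<open>C B - 1\<close> to a constant vector, and these columns are multiples of \<open>w\<close>.\<close>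

lemma kollar_transfer_comp:
  assumes a: "kollar_tuple a" and B: "kollar_transfer a a' B r" and C: "kollar_transfer a' a C s"
  shows "\<exists>\<sigma>. \<forall>i k. (\<Sum>j\<in>UNIV. C i j * B j k) = (if i = k then 1 else 0) + \<sigma> k * kollar_weight a i"
proof -
  have "\<exists>\<sigma>. \<forall>i. (\<Sum>j\<in>UNIV. C i j * B j k) = (if i = k then 1 else 0) + \<sigma> * kollar_weight a i" for k
  proof -
    define e v where "e = (\<lambda>i. \<Sum>j\<in>UNIV. C i j * B j k)"
      and "v = (\<lambda>i. int (e i) - (if i = k then 1 else 0))"
    have e: "a i * e i + e (i + 1) = kollar_exponent a i k + (r k + (\<Sum>j\<in>UNIV. s j * B j k))" for i
    proof -
      have "a i * e i + e (i + 1) = (\<Sum>j\<in>UNIV. (a i * C i j + C (i + 1) j) * B j k)"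
        by (simp add: e_def sum_distrib_left sum.distrib distrib_right mult.assoc)
      also have "\<dots> = (\<Sum>j\<in>UNIV. kollar_exponent a' i j * B j k) + (\<Sum>j\<in>UNIV. s j * B j k)"
        using C by (simp add: kollar_transfer_def distrib_right sum.distrib)
      also have "(\<Sum>j\<in>UNIV. kollar_exponent a' i j * B j k) = kollar_exponent a i k + r k"
        using B by (simp add: kollar_transfer_def sum_kollar_exponent)
      finally show ?thesis by simp
    qed
    have "int (a i) * v i + v (i + 1) = int (r k + (\<Sum>j\<in>UNIV. s j * B j k))" for i
    proof -
      have "int (a i) * int (e i) + int (e (i + 1))
          = int (kollar_exponent a i k) + int (r k + (\<Sum>j\<in>UNIV. s j * B j k))"
        using e[of i] by (metis of_nat_add of_nat_mult)
      then show ?thesis by (simp add: v_def kollar_exponent_def algebra_simps split: if_splits)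
    qed
    from cyclic_system_solution[OF a, OF this]
    obtain \<sigma> where \<sigma>: "\<And>i. v i = \<sigma> * int (kollar_weight a i)" by blast
    \<comment> \<open>An off-diagonal entry suffices to see that the multiple is not negative.\<close>
    have "v (k + 1) \<ge> 0" by (simp add: v_def distinct_4_cyclic)
    then have "\<sigma> \<ge> 0"
      using \<sigma>[of "k + 1"] kollar_weight_pos[OF a, of "k + 1"] by (simp add: zero_le_mult_iff)
    then have "int (e i) = int ((if i = k then 1 else 0) + nat \<sigma> * kollar_weight a i)" for i
      using \<sigma>[of i] by (auto simp: v_def)
    then show ?thesis unfolding of_nat_eq_iff e_def by blast
  qed
  then show ?thesis by metis
qed

lemma kollar_poly_transfer:
  assumes "kollar_transfer a a' B r"
  shows "kollar_poly a' (monomial_map B x) = (\<Prod>j\<in>UNIV. x $ j ^ r j) * kollar_poly a x"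
proof -
  have "monomial_map B x $ i ^ a' i * monomial_map B x $ (i + 1)
      = (\<Prod>j\<in>UNIV. x $ j ^ kollar_exponent a i j) * (\<Prod>j\<in>UNIV. x $ j ^ r j)" for i
  proof -
    have "monomial_map B x $ i ^ a' i * monomial_map B x $ (i + 1)
        = (\<Prod>j\<in>UNIV. x $ j ^ (a' i * B i j + B (i + 1) j))"
      by (simp add: monomial_map_def prod_power_distrib power_add prod.distrib mult.commute[of "a' i"]
         flip: power_mult)
    also have "\<dots> = (\<Prod>j\<in>UNIV. x $ j ^ (kollar_exponent a i j + r j))"
      using assms by (simp add: kollar_transfer_def)
    finally show ?thesis by (simp only: power_add prod.distrib)
  qed
  then show ?thesis
    by (simp add: kollar_poly_def[of a'] kollar_poly_exponent[of a] sum_distrib_left mult.commute)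
qed

text \<open>The open part of the Kollar surface where no coordinate vanishes.\<close>

definition kollar_torus :: "(4 \<Rightarrow> nat) \<Rightarrow> (complex ^ 4) set set" where
  "kollar_torus a = {p \<in> kollar_surface a. \<forall>x\<in>p. \<forall>i. x $ i \<noteq> 0}"

lemma worbit_in_kollar_torus:
  assumes a: "kollar_tuple a" and x: "kollar_poly a x = 0" "\<And>i. x $ i \<noteq> 0"
  shows "worbit (kollar_weight a) x \<in> kollar_torus a"
proof -
  have "x \<noteq> 0" using x(2)[of 1] by auto
  then have "worbit (kollar_weight a) x \<in> wproj (kollar_weight a)" by (simp add: wproj_def)
  moreover have "kollar_poly a y = 0 \<and> (\<forall>i. y $ i \<noteq> 0)" if y: "y \<in> worbit (kollar_weight a) x" for y
  proof -
    obtain t where t: "t \<noteq> 0" "y = wscale (kollar_weight a) t x" using y by (auto simp: worbit_def)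
    then show ?thesis
      using whomog_scale[OF whomog_kollar_poly[OF a]] x by (simp add: wscale_def)
  qed
  ultimately show ?thesis by (auto simp: kollar_torus_def kollar_surface_def wzeros_def)
qed

lemma kollar_torus_worbit:
  assumes "p \<in> kollar_torus a"
  obtains x where "p = worbit (kollar_weight a) x" "kollar_poly a x = 0" "\<forall>i. x $ i \<noteq> 0"
proof -
  have p: "p \<in> wproj (kollar_weight a)" "\<forall>x\<in>p. kollar_poly a x = 0 \<and> (\<forall>i. x $ i \<noteq> 0)"
    using assms by (auto simp: kollar_torus_def kollar_surface_def wzeros_def)
  then obtain x where "x \<in> p" using wproj_nonempty by blast
  then show ?thesis using that p wproj_eq_worbit by metis
qed

lemma kollar_torus_subset: "kollar_torus a \<subseteq> wproj (kollar_weight a)"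
  by (auto simp: kollar_torus_def kollar_surface_def wzeros_def)

lemma kollar_transfer_morphism:
  assumes a: "kollar_tuple a" "kollar_tuple a'" and B: "kollar_transfer a a' B r"
  shows "variety_morphism (kollar_weight a) (kollar_torus a) (kollar_weight a') (kollar_torus a')
      (orbit_map (kollar_weight a') (monomial_map B))" (is ?mor)
    and "orbit_map (kollar_weight a') (monomial_map B) (worbit (kollar_weight a) x)
      = worbit (kollar_weight a') (monomial_map B x)" (is ?orb)
proof -
  obtain \<mu> where \<mu>: "\<And>i. (\<Sum>j\<in>UNIV. B i j * kollar_weight a j) = \<mu> * kollar_weight a' i"
    using kollar_transfer_weight[OF a B] by blast
  have equi: "\<exists>s. s \<noteq> 0 \<and>
      monomial_map B (wscale (kollar_weight a) t x) = wscale (kollar_weight a') s (monomial_map B x)"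
    if "t \<noteq> 0" for t x
    using monomial_map_wscale[of B, OF \<mu>] that by (intro exI[of _ "t ^ \<mu>"]) simp
  have orb: "orbit_map (kollar_weight a') (monomial_map B) (worbit (kollar_weight a) x)
      = worbit (kollar_weight a') (monomial_map B x)" for x
    by (rule orbit_map_worbit) (rule equi)
  then show ?orb .
  show ?mor
  proof (rule variety_morphism_orbit_map[where G = "monomial_map B" and w = "kollar_weight a"
        and v = "kollar_weight a'" and \<mu> = \<mu>])
    show "whomog (kollar_weight a) (\<mu> * d) (\<lambda>x. f (monomial_map B x))"
      if "whomog (kollar_weight a') d f" for d f
      by (rule whomog_monomial_map[OF \<mu> that])
    fix p assume "p \<in> kollar_torus a"
    then obtain x where x: "p = worbit (kollar_weight a) x" "kollar_poly a x = 0" "\<forall>i. x $ i \<noteq> 0"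
      by (rule kollar_torus_worbit)
    show "orbit_map (kollar_weight a') (monomial_map B) p \<in> kollar_torus a'"
      unfolding x(1) orb
    proof (rule worbit_in_kollar_torus[OF a(2)])
      show "kollar_poly a' (monomial_map B x) = 0"
        using x(2) by (simp add: kollar_poly_transfer[OF B])
      show "monomial_map B x $ i \<noteq> 0" for i
        using x(3) by (simp add: monomial_map_def)
    qed
  next
    show "\<exists>s. s \<noteq> 0 \<and> monomial_map B (wscale (kollar_weight a) t x)
        = wscale (kollar_weight a') s (monomial_map B x)" if "t \<noteq> 0" for t x
      by (rule equi[OF that])
  qed (rule kollar_torus_subset)+
qed

text \<open>The composition multiplies the \<open>i\<close>-th coordinate by \<open>t ^ w\<^sub>i\<close>, where \<open>t\<close> is the monomial with
  exponents \<open>\<sigma>\<close>; on orbits this is the identity.\<close>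

lemma kollar_transfer_inverse:
  assumes a: "kollar_tuple a" "kollar_tuple a'"
    and B: "kollar_transfer a a' B r" and C: "kollar_transfer a' a C s"
    and p: "p \<in> kollar_torus a"
  shows "orbit_map (kollar_weight a) (monomial_map C)
      (orbit_map (kollar_weight a') (monomial_map B) p) = p"
proof -
  obtain x where x: "p = worbit (kollar_weight a) x" "kollar_poly a x = 0" "\<forall>i. x $ i \<noteq> 0"
    using p by (rule kollar_torus_worbit)
  obtain \<sigma> where \<sigma>: "\<And>i k. (\<Sum>j\<in>UNIV. C i j * B j k) = (if i = k then 1 else 0) + \<sigma> k * kollar_weight a i"
    using kollar_transfer_comp[OF a(1) B C] by metis
  define t where "t = (\<Prod>k\<in>UNIV. x $ k ^ \<sigma> k)"
  have "t \<noteq> 0" using x(3) by (simp add: t_def)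
  have "monomial_map C (monomial_map B x) $ i = t ^ kollar_weight a i * x $ i" for i
  proof -
    have "monomial_map C (monomial_map B x) $ i
        = (\<Prod>k\<in>UNIV. x $ k ^ ((if i = k then 1 else 0) + \<sigma> k * kollar_weight a i))"
      unfolding monomial_map_comp \<sigma> by (simp add: monomial_map_def)
    also have "\<dots> = (\<Prod>k\<in>UNIV. if i = k then x $ k else 1) * (\<Prod>k\<in>UNIV. (x $ k ^ \<sigma> k) ^ kollar_weight a i)"
      unfolding prod.distrib[symmetric] by (rule prod.cong) (simp_all add: power_mult)
    finally show ?thesis by (simp add: t_def prod_power_distrib)
  qed
  then have "monomial_map C (monomial_map B x) = wscale (kollar_weight a) t x"
    by (simp add: wscale_def vec_eq_iff)
  then show ?thesis
    unfolding x(1) kollar_transfer_morphism(2)[OF a B] kollar_transfer_morphism(2)[OF a(2,1) C]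
    using worbit_wscale[OF \<open>t \<noteq> 0\<close>] by simp
qed

lemma kollar_torus_isomorphic:
  assumes a: "kollar_tuple a" "kollar_tuple a'" and N: "kollar_wstar a' = kollar_wstar a"
    and cong: "\<And>j. int (kollar_wstar a) dvd int (a' j) - int (a j)"
  shows "isomorphic_varieties (kollar_weight a) (kollar_torus a) (kollar_weight a') (kollar_torus a')"
proof -
  have cong': "int (kollar_wstar a') dvd int (a j) - int (a' j)" for j
    using cong[of j] unfolding N by (simp add: dvd_diff_commute)
  obtain B r where B: "kollar_transfer a a' B r"
    using kollar_transfer_exists[OF a(2) cong'] by blast
  obtain C s where C: "kollar_transfer a' a C s"
    using kollar_transfer_exists[OF a(1) cong] by blast
  show ?thesis
    unfolding isomorphic_varieties_def
    using kollar_transfer_morphism(1)[OF a B] kollar_transfer_morphism(1)[OF a(2,1) C]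
      kollar_transfer_inverse[OF a B C] kollar_transfer_inverse[OF a(2,1) C B]
    by blast
qed

section \<open>Density of the torus in the Kollar surface\<close>

text \<open>The product of the roots is, up to sign, the quotient of the constant and the leading coefficient,
  so the root of least modulus satisfies this bound.\<close>

lemma poly_small_root:
  fixes P :: "complex poly"
  assumes "degree P > 0"
  shows "\<exists>z. poly P z = 0 \<and> norm (lead_coeff P) * norm z ^ degree P \<le> norm (poly P 0)"
proof -
  obtain \<rho> where \<rho>: "smult (lead_coeff P) (\<Prod>i<degree P. [:- \<rho> i, 1:]) = P"
    by (rule complex_poly_decompose')
  have P: "poly P x = lead_coeff P * (\<Prod>i<degree P. x - \<rho> i)" for x
    by (subst \<rho>[symmetric]) (simp add: poly_prod)
  have "finite {..<degree P}" "{..<degree P} \<noteq> {}" using assms by auto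
  then obtain j where j: "j < degree P" "\<And>i. i < degree P \<Longrightarrow> norm (\<rho> j) \<le> norm (\<rho> i)"
    using ex_min_if_finite[of "(\<lambda>i. norm (\<rho> i)) ` {..<degree P}"] by (auto simp: not_less)
  have "norm (\<rho> j) ^ degree P = (\<Prod>i<degree P. norm (\<rho> j))" by simp
  also have "\<dots> \<le> (\<Prod>i<degree P. norm (\<rho> i))"
    by (rule prod_mono) (use j(2) in auto)
  finally have "norm (lead_coeff P) * norm (\<rho> j) ^ degree P \<le> norm (poly P 0)"
    unfolding P by (simp add: norm_mult mult_left_mono flip: prod_norm)
  moreover have "poly P (\<rho> j) = 0" unfolding P using j(1) by auto
  ultimately show ?thesis by blast
qed

lemma sequence_avoiding:
  fixes z :: complex
  assumes "\<And>n. finite (K n)"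
  obtains y :: "nat \<Rightarrow> complex" where "y \<longlonglongrightarrow> z" "\<And>n. y n \<notin> K n"
proof -
  have "\<exists>y. dist y z < inverse (real (Suc n)) \<and> y \<notin> K n" for n
  proof -
    have "infinite (ball z (inverse (real (Suc n))))"
      using islimpt_UNIV[of z] unfolding islimpt_eq_infinite_ball by simp
    then have "\<not> ball z (inverse (real (Suc n))) \<subseteq> K n"
      using assms finite_subset by blast
    then show ?thesis by (auto simp: dist_commute)
  qed
  then obtain y where y: "\<And>n. dist (y n) z < inverse (real (Suc n))" "\<And>n. y n \<notin> K n"
    by metis
  have "(\<lambda>n. dist (y n) z) \<longlonglongrightarrow> 0"
    by (rule tendsto_sandwich[OF _ _ tendsto_const LIMSEQ_inverse_real_of_nat])
      (use y(1) in \<open>auto intro!: always_eventually less_imp_le\<close>)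
  then have "y \<longlonglongrightarrow> z" by (rule tendsto_dist_iff[THEN iffD2])
  then show ?thesis using that y(2) by blast
qed

lemma tendsto_zero_if_power:
  fixes t :: "nat \<Rightarrow> 'a::real_normed_vector"
  assumes "n > 0" and "\<And>k. norm (t k) ^ n \<le> g k" and "g \<longlonglongrightarrow> 0"
  shows "t \<longlonglongrightarrow> 0"
proof -
  have "(\<lambda>k. norm (t k) ^ n) \<longlonglongrightarrow> 0"
    by (rule tendsto_sandwich[OF _ _ tendsto_const assms(3)]) (use assms(2) in auto)
  then have "(\<lambda>k. root n (norm (t k) ^ n)) \<longlonglongrightarrow> root n 0"
    by (rule tendsto_real_root)
  then show ?thesis
    using assms(1) by (simp add: real_root_power_cancel tendsto_norm_zero_iff)
qed

text \<open>Four coordinates listed cyclically from the index \<open>i\<close> onwards, so that one argument covers all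
  four coordinate hyperplanes.\<close>

definition vec4 :: "4 \<Rightarrow> complex \<Rightarrow> complex \<Rightarrow> complex \<Rightarrow> complex \<Rightarrow> complex ^ 4" where
  "vec4 i p q r s = (\<chi> k. if k = i then p else if k = i + 1 then q else if k = i + 2 then r else s)"

lemma vec4_nth:
  "vec4 i p q r s $ i = p" "vec4 i p q r s $ (i + 1) = q"
  "vec4 i p q r s $ (i + 2) = r" "vec4 i p q r s $ (i + 3) = s"
  by (simp_all add: vec4_def distinct_4_cyclic)

lemma vec4_collapse: "vec4 i (x $ i) (x $ (i + 1)) (x $ (i + 2)) (x $ (i + 3)) = x"
  unfolding vec_eq_iff all_4_cyclic[of _ i] by (simp add: vec4_nth)

lemma kollar_poly_vec4:
  "kollar_poly a (vec4 i p q r s) =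
    p ^ a i * q + q ^ a (i + 1) * r + r ^ a (i + 2) * s + s ^ a (i + 3) * p"
  unfolding kollar_poly_def sum_4_cyclic[of _ i] by (simp add: cyclic_4_add vec4_nth)

lemma tendsto_vec4:
  assumes "p \<longlonglongrightarrow> p'" "q \<longlonglongrightarrow> q'" "r \<longlonglongrightarrow> r'" "s \<longlonglongrightarrow> s'"
  shows "(\<lambda>n. vec4 i (p n) (q n) (r n) (s n)) \<longlonglongrightarrow> vec4 i p' q' r' s'"
  by (rule vec_tendstoI) (simp add: vec4_def assms)

lemma closure_by_sequence:
  fixes y :: "'a::metric_space"
  assumes "\<And>n. z n \<in> S" "z \<longlonglongrightarrow> y"
  shows "y \<in> closure S"
  using assms closure_sequential[of y S] by blast

text \<open>With \<open>(p, q, r, s)\<close> for the coordinates and \<open>A\<close>, \<open>B\<close>, \<open>C\<close>, \<open>E\<close> for the exponents, the equation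
  reads \<open>p\<^sup>A q + (q\<^sup>B r + r\<^sup>C s) + s\<^sup>E p = 0\<close>. As a polynomial in \<open>p\<close> it has the constant term
  \<open>R = q\<^sup>B r + r\<^sup>C s\<close>. Small changes of \<open>r\<close> and \<open>s\<close> make \<open>R\<close> nonzero but small. Then every root
  \<open>p\<close> is nonzero and some root is small, as the leading coefficient in \<open>p\<close> stays away from 0. This
  coefficient is \<open>q\<close>, or \<open>q + s\<^sup>E\<close> if \<open>A = 1\<close>.\<close>

lemma kollar_smooth_boundary_in_closure:
  assumes a: "kollar_tuple a" and y: "kollar_poly a (vec4 i 0 q r s) = 0" and q: "q \<noteq> 0"
    and 1: "a i = 1 \<Longrightarrow> q + s ^ a (i + 3) \<noteq> 0"
  shows "vec4 i 0 q r s \<in> closure {z. kollar_poly a z = 0 \<and> z $ i \<noteq> 0}"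
proof -
  define A B C E where "A = a i" and "B = a (i + 1)" and "C = a (i + 2)" and "E = a (i + 3)"
  have pos: "A > 0" "B > 0" "C > 0" "E > 0"
    using a by (simp_all add: kollar_tuple_def A_def B_def C_def E_def)
  have R0: "q ^ B * r + r ^ C * s = 0"
    using y pos unfolding kollar_poly_vec4 A_def[symmetric] B_def[symmetric] C_def[symmetric] E_def[symmetric]
    by (simp add: zero_power)
  obtain r' where r': "r' \<longlonglongrightarrow> r" "\<And>n. r' n \<notin> {0}"
    by (rule sequence_avoiding[of "\<lambda>_. {0}" r]) auto
  define K where "K = (\<lambda>n. {- (q ^ B * r' n) / r' n ^ C} \<union> {z. z ^ E = - q})"
  have "finite (K n)" for n
    using finite_nth_roots[OF pos(4)] by (simp add: K_def)
  then obtain s' where s': "s' \<longlonglongrightarrow> s"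
      "\<And>n. s' n \<notin> K n"
    by (rule sequence_avoiding[of K s]) blast
  define R where "R = (\<lambda>n. q ^ B * r' n + r' n ^ C * s' n)"
  have Rlim: "R \<longlonglongrightarrow> 0"
    using tendsto_add[OF tendsto_mult[OF tendsto_const r'(1)] tendsto_mult[OF tendsto_power[OF r'(1)] s'(1)]]
    unfolding R_def R0[symmetric] .
  have Rnz: "R n \<noteq> 0" for n
  proof
    assume "R n = 0"
    then have "s' n = - (q ^ B * r' n) / r' n ^ C"
      using r'(2)[of n] by (simp add: R_def field_simps add_eq_0_iff)
    then show False using s'(2)[of n] by (simp add: K_def)
  qed
  have "\<exists>t. t \<longlonglongrightarrow> 0 \<and> (\<forall>n. t n ^ A * q + R n + s' n ^ E * t n = 0)"
  proof (cases "A = 1")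
    case True
    have nz: "q + s' n ^ E \<noteq> 0" for n
      using s'(2)[of n] by (auto simp: K_def add_eq_0_iff)
    define t where "t = (\<lambda>n. - R n / (q + s' n ^ E))"
    have "t \<longlonglongrightarrow> - 0 / (q + s ^ E)"
      unfolding t_def using 1 True
      by (intro tendsto_intros Rlim s'(1)) (simp_all add: A_def E_def)
    moreover have "t n ^ A * q + R n + s' n ^ E * t n = 0" for n
    proof -
      have "t n ^ A * q + R n + s' n ^ E * t n = R n + t n * (q + s' n ^ E)"
        using True by (simp add: algebra_simps)
      then show ?thesis using nz[of n] by (simp add: t_def)
    qed
    ultimately show ?thesis by (intro exI[of _ t]) simp
  next
    case False
    then have A: "A > 1" using pos by simp
    have "\<exists>t. t ^ A * q + R n + s' n ^ E * t = 0 \<and> norm t ^ A \<le> norm (R n) / norm q" for n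
    proof -
      define P where "P = (monom (s' n ^ E) 1 + [:R n:]) + monom q A"
      have "degree (monom (s' n ^ E) 1 + [:R n:]) \<le> 1"
        by (intro degree_add_le degree_monom_le) simp
      then have less: "degree (monom (s' n ^ E) 1 + [:R n:]) < degree (monom q A)"
        using A q by (simp add: degree_monom_eq)
      have deg: "degree P = A"
        unfolding P_def degree_add_eq_right[OF less] using q by (simp add: degree_monom_eq)
      have lead: "lead_coeff P = q"
        unfolding P_def lead_coeff_add_le[OF less] using q by (simp add: degree_monom_eq)
      have P: "poly P t = t ^ A * q + R n + s' n ^ E * t" for t
        by (simp add: P_def poly_monom)
      obtain t where t: "poly P t = 0" "norm q * norm t ^ A \<le> norm (poly P 0)"
        using poly_small_root[of P, unfolded lead, unfolded deg] A by auto
      have "norm (poly P 0) = norm (R n)" using A by (simp add: P zero_power)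
      then show ?thesis using t q unfolding P by (intro exI[of _ t]) (simp add: field_simps)
    qed
    then obtain t where t: "\<And>n. t n ^ A * q + R n + s' n ^ E * t n = 0"
        "\<And>n. norm (t n) ^ A \<le> norm (R n) / norm q"
      by metis
    have "(\<lambda>n. norm (R n) / norm q) \<longlonglongrightarrow> 0"
      using tendsto_divide[OF tendsto_norm[OF Rlim] tendsto_const] q by force
    then have "t \<longlonglongrightarrow> 0" by (rule tendsto_zero_if_power[OF pos(1) t(2)])
    then show ?thesis using t(1) by blast
  qed
  then obtain t where t: "t \<longlonglongrightarrow> 0" "\<And>n. t n ^ A * q + R n + s' n ^ E * t n = 0" by blast
  have tnz: "t n \<noteq> 0" for n
    using t(2)[of n] Rnz[of n] pos by (auto simp: zero_power)
  show ?thesis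
  proof (rule closure_by_sequence)
    show "(\<lambda>n. vec4 i (t n) q (r' n) (s' n)) \<longlonglongrightarrow> vec4 i 0 q r s"
      by (intro tendsto_vec4 t r' s' tendsto_const)
    show "vec4 i (t n) q (r' n) (s' n) \<in> {z. kollar_poly a z = 0 \<and> z $ i \<noteq> 0}" for n
      using t(2)[of n] tnz[of n]
      by (simp add: kollar_poly_vec4 vec4_nth R_def A_def B_def C_def E_def algebra_simps)
  qed
qed

text \<open>On the hyperplane \<open>p = 0\<close> the equation is \<open>r (q\<^sup>B + r\<^bsup>C-1\<^esup> s) = 0\<close>. Where \<open>r = 0\<close>, the coordinate
  \<open>q\<close> moves freely. Elsewhere \<open>s\<close> is a function of \<open>q\<close> and \<open>r\<close>, which move freely; if \<open>A = 1\<close>,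
  then \<open>C \<noteq> 1\<close> by the condition on Kollar tuples, so that \<open>s\<close> really depends on \<open>r\<close> and moving \<open>r\<close>
  makes \<open>q + s\<^sup>E\<close> nonzero.\<close>

lemma kollar_boundary_in_closure:
  assumes a: "kollar_tuple a" and x: "kollar_poly a (vec4 i 0 q r s) = 0"
  shows "vec4 i 0 q r s \<in> closure {vec4 i 0 q' r' s' | q' r' s'.
    kollar_poly a (vec4 i 0 q' r' s') = 0 \<and> q' \<noteq> 0 \<and> (a i = 1 \<longrightarrow> q' + s' ^ a (i + 3) \<noteq> 0)}"
    (is "_ \<in> closure ?G")
proof -
  define A B C E where "A = a i" and "B = a (i + 1)" and "C = a (i + 2)" and "E = a (i + 3)"
  have pos: "A > 0" "B > 0" "C > 0" "E > 0"
    using a by (simp_all add: kollar_tuple_def A_def B_def C_def E_def)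
  then obtain c where c: "C = Suc c" using gr0_implies_Suc by blast
  have AC: "A = 1 \<Longrightarrow> c > 0"
    using a c by (auto simp: kollar_tuple_def A_def C_def dest!: spec[of _ i])
  have G: "vec4 i 0 q' r' s' \<in> ?G"
    if "q' ^ B * r' + r' ^ C * s' = 0" "q' \<noteq> 0" "A = 1 \<Longrightarrow> q' + s' ^ E \<noteq> 0" for q' r' s'
    unfolding mem_Collect_eq
    by (intro exI[of _ q'] exI[of _ r'] exI[of _ s'] conjI refl)
      (use that pos in \<open>simp_all add: kollar_poly_vec4 zero_power A_def B_def C_def E_def\<close>)
  have R0: "q ^ B * r + r ^ C * s = 0"
    using x pos unfolding kollar_poly_vec4 A_def[symmetric] B_def[symmetric] C_def[symmetric] E_def[symmetric]
    by (simp add: zero_power)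
  show ?thesis
  proof (cases "r = 0")
    case True
    obtain q' where q': "q' \<longlonglongrightarrow> q" "\<And>n. q' n \<notin> {0, - (s ^ E)}"
      by (rule sequence_avoiding[of "\<lambda>_. {0, - (s ^ E)}" q]) auto
    show ?thesis
    proof (rule closure_by_sequence)
      show "(\<lambda>n. vec4 i 0 (q' n) 0 s) \<longlonglongrightarrow> vec4 i 0 q r s"
        unfolding True by (intro tendsto_vec4 q' tendsto_const)
      show "vec4 i 0 (q' n) 0 s \<in> ?G" for n
        by (rule G) (use q'(2)[of n] pos in \<open>auto simp: add_eq_0_iff2\<close>)
    qed
  next
    case False
    have "r * (q ^ B + r ^ c * s) = 0" using R0 c by (simp add: algebra_simps)
    then have rs: "r ^ c * s = - (q ^ B)"
      using False by (simp add: add_eq_0_iff)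
    have s: "s = - (q ^ B) / r ^ c"
      unfolding rs[symmetric] using False by simp
    obtain q' where q': "q' \<longlonglongrightarrow> q" "\<And>n. q' n \<notin> {0}"
      by (rule sequence_avoiding[of "\<lambda>_. {0}" q]) auto
    define K where "K = (\<lambda>n. insert 0 (if c = 0 then {} else {\<rho>. \<rho> ^ (c * E) = (- (q' n ^ B)) ^ E / - q' n}))"
    have "finite (K n)" for n
      using finite_nth_roots[of "c * E"] pos by (simp add: K_def)
    then obtain r' where r': "r' \<longlonglongrightarrow> r" "\<And>n. r' n \<notin> K n"
      by (rule sequence_avoiding[of K r]) blast
    have nz: "r' n \<noteq> 0" "q' n \<noteq> 0" for n using r'(2)[of n] q'(2)[of n] by (auto simp: K_def)
    define s' where "s' = (\<lambda>n. - (q' n ^ B) / r' n ^ c)"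
    have "s' \<longlonglongrightarrow> s"
      unfolding s s'_def using False by (intro tendsto_intros q' r') simp
    show ?thesis
    proof (rule closure_by_sequence)
      show "(\<lambda>n. vec4 i 0 (q' n) (r' n) (s' n)) \<longlonglongrightarrow> vec4 i 0 q r s"
        by (intro tendsto_vec4 q' r' \<open>s' \<longlonglongrightarrow> s\<close> tendsto_const)
      show "vec4 i 0 (q' n) (r' n) (s' n) \<in> ?G" for n
      proof (rule G)
        show "q' n ^ B * r' n + r' n ^ C * s' n = 0"
          using nz by (simp add: s'_def c)
        show "q' n \<noteq> 0" by (rule nz)
        assume "A = 1"
        then have "c > 0" by (rule AC)
        show "q' n + s' n ^ E \<noteq> 0"
        proof
          assume "q' n + s' n ^ E = 0"
          then have "s' n ^ E = - q' n" by (simp add: add_eq_0_iff)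
          moreover have "s' n ^ E = (- (q' n ^ B)) ^ E / r' n ^ (c * E)"
            by (simp only: s'_def power_divide power_mult)
          ultimately have "(- (q' n ^ B)) ^ E / r' n ^ (c * E) = - q' n" by simp
          then have "r' n ^ (c * E) = (- (q' n ^ B)) ^ E / - q' n"
            using nz by (simp add: divide_eq_eq eq_divide_eq mult.commute)
          then show False using r'(2)[of n] \<open>c > 0\<close> by (simp add: K_def)
        qed
      qed
    qed
  qed
qed

lemma kollar_zero_in_closure:
  assumes a: "kollar_tuple a" and x: "kollar_poly a x = 0"
  shows "x \<in> closure {z. kollar_poly a z = 0 \<and> z $ i \<noteq> 0}" (is "_ \<in> closure ?S")
proof (cases "x $ i = 0")
  case True
  have x4: "x = vec4 i 0 (x $ (i + 1)) (x $ (i + 2)) (x $ (i + 3))"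
    using vec4_collapse[of i x] True by simp
  let ?G = "{vec4 i 0 q' r' s' | q' r' s'.
    kollar_poly a (vec4 i 0 q' r' s') = 0 \<and> q' \<noteq> 0 \<and> (a i = 1 \<longrightarrow> q' + s' ^ a (i + 3) \<noteq> 0)}"
  have "?G \<subseteq> closure ?S"
    using kollar_smooth_boundary_in_closure[OF a] by blast
  then have "closure ?G \<subseteq> closure ?S"
    by (rule closure_minimal) simp
  moreover have "x \<in> closure ?G"
    using kollar_boundary_in_closure[OF a, of i "x $ (i + 1)" "x $ (i + 2)" "x $ (i + 3)"] x x4 by simp
  ultimately show ?thesis by blast
next
  case False
  then have "x \<in> ?S" using x by simp
  then show ?thesis by (rule closure_subset[THEN subsetD])
qed

text \<open>A finite intersection of open dense subsets of the affine cone is dense, so the coordinates can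
  be treated one at a time.\<close>

lemma kollar_torus_points_dense:
  assumes a: "kollar_tuple a" and x: "kollar_poly a x = 0"
  shows "x \<in> closure {z. kollar_poly a z = 0 \<and> (\<forall>i. z $ i \<noteq> 0)}"
proof -
  define Z where "Z = (\<lambda>I. {z. kollar_poly a z = 0 \<and> (\<forall>i\<in>I. z $ i \<noteq> 0)})"
  have "Z {} \<subseteq> closure (Z I)" if "finite I" for I
    using that
  proof (induction I)
    case (insert j I)
    define O' where "O' = {z :: complex ^ 4. \<forall>i\<in>I. z $ i \<noteq> 0}"
    have "O' = (\<Inter>i\<in>I. {z. z $ i \<noteq> 0})" by (auto simp: O'_def)
    moreover have "open (\<Inter>i\<in>I. {z :: complex ^ 4. z $ i \<noteq> 0})"
      using insert(1) by (intro open_INT ballI open_Collect_neq continuous_intros) auto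
    ultimately have "open O'" by simp
    have "Z I \<subseteq> O' \<inter> closure (Z {j})"
      using kollar_zero_in_closure[OF a, of _ j] by (auto simp: Z_def O'_def)
    also have "\<dots> \<subseteq> closure (O' \<inter> Z {j})"
      by (rule open_Int_closure_subset[OF \<open>open O'\<close>])
    also have "O' \<inter> Z {j} = Z (insert j I)" by (auto simp: Z_def O'_def)
    finally have "closure (Z I) \<subseteq> closure (Z (insert j I))"
      by (rule closure_minimal) simp
    then show ?case using insert.IH by blast
  qed (rule closure_subset)
  from this[of UNIV] show ?thesis using x by (auto simp: Z_def)
qed

lemma openin_zariski_nonzero:
  assumes "whomog w d f"
  shows "openin (zariski w) (wproj w - wzeros w {f})"
proof -
  have "wclosed w (wzeros w {f})"
    unfolding wclosed_def using assms by (intro exI[of _ "{f}"]) auto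
  then show ?thesis unfolding openin_zariski by (intro exI[of _ "wzeros w {f}"] conjI) simp_all
qed

lemma openin_zariskiE:
  assumes "openin (zariski w) U"
  obtains S where "\<forall>f\<in>S. \<exists>d. whomog w d f" "U = wproj w - wzeros w S"
proof -
  obtain C where "wclosed w C" "U = wproj w - C"
    using assms unfolding openin_zariski by (elim exE conjE)
  then show thesis using that unfolding wclosed_def by (elim exE conjE) simp
qed

lemma whomog_continuous_on:
  assumes "whomog w d f"
  shows "continuous_on UNIV f"
proof -
  obtain M c where "f = (\<lambda>x. \<Sum>m\<in>M. c m * (\<Prod>i\<in>UNIV. x $ i ^ m i))"
    using assms by (auto simp: whomog_def)
  then show ?thesis by (simp only:) (intro continuous_intros)
qed

text \<open>Homogeneous polynomials are continuous for the Euclidean topology, so density there implies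
  density for the coarser Zariski topology.\<close>

lemma dense_open_kollar_torus:
  assumes a: "kollar_tuple a"
  shows "dense_open_in (kollar_weight a) (kollar_surface a) (kollar_torus a)"
proof -
  let ?w = "kollar_weight a" and ?X = "kollar_surface a"
  have X: "?X \<subseteq> wproj ?w" by (auto simp: kollar_surface_def wzeros_def)
  then have top: "topspace (subtopology (zariski ?w) ?X) = ?X" by (auto simp: topspace_zariski)
  define g where "g = (\<lambda>x :: complex ^ 4. \<Sum>k\<in>{()}. 1 * (\<Prod>i\<in>UNIV. x $ i ^ 1))"
  have g: "whomog ?w (\<Sum>i\<in>UNIV. ?w i * 1) g"
    unfolding g_def by (rule whomog_sum_monomials[of _ _ "\<lambda>_ _. 1"]) simp_all
  have g0: "g x = 0 \<longleftrightarrow> (\<exists>i. x $ i = 0)" for x by (simp add: g_def)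
  have "kollar_torus a = (wproj ?w - wzeros ?w {g}) \<inter> ?X"
  proof
    show "kollar_torus a \<subseteq> (wproj ?w - wzeros ?w {g}) \<inter> ?X"
    proof
      fix p assume p: "p \<in> kollar_torus a"
      then have p': "p \<in> ?X" "\<forall>x\<in>p. \<forall>i. x $ i \<noteq> 0" by (simp_all add: kollar_torus_def)
      obtain x where "x \<in> p" using p'(1) X wproj_nonempty by blast
      then have "x \<in> p" "g x \<noteq> 0" using p'(2) g0 by auto
      then have "p \<notin> wzeros ?w {g}" by (auto simp: wzeros_def)
      then show "p \<in> (wproj ?w - wzeros ?w {g}) \<inter> ?X" using p'(1) X by blast
    qed
    show "(wproj ?w - wzeros ?w {g}) \<inter> ?X \<subseteq> kollar_torus a"
    proof
      fix p assume p: "p \<in> (wproj ?w - wzeros ?w {g}) \<inter> ?X"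
      then obtain x where x: "x \<in> p" "g x \<noteq> 0" by (auto simp: wzeros_def)
      then have "g y \<noteq> 0" if "y \<in> p" for y
        using whomog_zero_on_orbit[OF _ g that x(1)] p by blast
      then show "p \<in> kollar_torus a" using p g0 by (auto simp: kollar_torus_def)
    qed
  qed
  moreover have "openin (zariski ?w) (wproj ?w - wzeros ?w {g})"
    using g by (rule openin_zariski_nonzero)
  ultimately have op: "openin (subtopology (zariski ?w) ?X) (kollar_torus a)"
    unfolding openin_subtopology by (intro exI conjI)
  have dense: "p \<in> subtopology (zariski ?w) ?X closure_of kollar_torus a" if p: "p \<in> ?X" for p
    unfolding in_closure_of top
  proof (intro conjI allI impI)
    fix T assume T: "p \<in> T \<and> openin (subtopology (zariski ?w) ?X) T"
    then obtain T1 where T1: "openin (zariski ?w) T1" "T = T1 \<inter> ?X"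
      unfolding openin_subtopology by blast
    obtain S where S: "\<forall>f\<in>S. \<exists>d. whomog ?w d f" "T1 = wproj ?w - wzeros ?w S"
      using T1(1) by (rule openin_zariskiE)
    have "p \<in> wproj ?w" "p \<notin> wzeros ?w S" using T T1(2) S(2) by blast+
    then obtain x f where x: "x \<in> p" "f \<in> S" "f x \<noteq> 0"
      by (auto simp: wzeros_def)
    obtain d where "whomog ?w d f" using S(1) x(2) by blast
    then have "continuous_on UNIV f" by (rule whomog_continuous_on)
    then have "open {z. f z \<noteq> 0}" by (intro open_Collect_neq continuous_on_const)
    moreover have "x \<in> closure {z. kollar_poly a z = 0 \<and> (\<forall>i. z $ i \<noteq> 0)}"
      using p x(1) by (intro kollar_torus_points_dense[OF a]) (auto simp: kollar_surface_def wzeros_def)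
    ultimately have "{z. f z \<noteq> 0} \<inter> {z. kollar_poly a z = 0 \<and> (\<forall>i. z $ i \<noteq> 0)} \<noteq> {}"
      using x(3) open_Int_closure_eq_empty by blast
    then obtain z where z: "f z \<noteq> 0" "kollar_poly a z = 0" "\<And>i. z $ i \<noteq> 0" by blast
    let ?q = "worbit ?w z"
    have q: "?q \<in> kollar_torus a" by (rule worbit_in_kollar_torus[OF a z(2,3)])
    moreover have "?q \<notin> wzeros ?w S" using z(1) x(2) self_in_worbit[of z ?w] by (auto simp: wzeros_def)
    ultimately have "?q \<in> T1" using kollar_torus_subset[of a] S(2) by blast
    moreover have "?q \<in> ?X" using q by (simp add: kollar_torus_def)
    ultimately have "?q \<in> T" using T1(2) by blast
    then show "\<exists>y. y \<in> kollar_torus a \<and> y \<in> T" using q by blast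
  qed (rule p)
  have "subtopology (zariski ?w) ?X closure_of kollar_torus a \<subseteq> ?X"
    using closure_of_subset_topspace[of "subtopology (zariski ?w) ?X" "kollar_torus a"] top by simp
  then have "subtopology (zariski ?w) ?X closure_of kollar_torus a = ?X"
    using dense by blast
  then show ?thesis
    unfolding dense_open_in_def using op by simp
qed

theorem kollar_surface_birational:
  assumes a: "kollar_tuple a" "kollar_tuple a'" and "kollar_wstar a' = kollar_wstar a"
    and "\<And>j. int (kollar_wstar a) dvd int (a' j) - int (a j)"
  shows "birational (kollar_weight a) (kollar_surface a) (kollar_weight a') (kollar_surface a')"
  unfolding birational_def
  using dense_open_kollar_torus[OF a(1)] dense_open_kollar_torus[OF a(2)]
    kollar_torus_isomorphic[OF assms] by blast

section \<open>Infinitely many birational models with coprime opposite weights\<close>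

lemma kollar_W_values:
  assumes "kollar_tuple a"
  shows "int (kollar_W a 1) = int (a 2) * int (a 3) * int (a 4) - int (a 3) * int (a 4) + int (a 4) - 1"
    and "int (kollar_W a 2) = int (a 3) * int (a 4) * int (a 1) - int (a 4) * int (a 1) + int (a 1) - 1"
    and "int (kollar_W a 3) = int (a 4) * int (a 1) * int (a 2) - int (a 1) * int (a 2) + int (a 2) - 1"
    and "int (kollar_W a 4) = int (a 1) * int (a 2) * int (a 3) - int (a 2) * int (a 3) + int (a 3) - 1"
proof -
  have "(1::4) + 1 = 2" "(1::4) + 2 = 3" "(1::4) + 3 = 4" "(2::4) + 1 = 3" "(2::4) + 2 = 4"
    "(2::4) + 3 = 1" "(3::4) + 1 = 4" "(3::4) + 2 = 1" "(3::4) + 3 = 2"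
    "(4::4) + 1 = 1" "(4::4) + 2 = 2" "(4::4) + 3 = 3"
    by simp_all
  then show "int (kollar_W a 1) = int (a 2) * int (a 3) * int (a 4) - int (a 3) * int (a 4) + int (a 4) - 1"
    "int (kollar_W a 2) = int (a 3) * int (a 4) * int (a 1) - int (a 4) * int (a 1) + int (a 1) - 1"
    "int (kollar_W a 3) = int (a 4) * int (a 1) * int (a 2) - int (a 1) * int (a 2) + int (a 2) - 1"
    "int (kollar_W a 4) = int (a 1) * int (a 2) * int (a 3) - int (a 2) * int (a 3) + int (a 3) - 1"
    by (simp_all only: int_kollar_W[OF assms])
qed

text \<open>For \<open>a' \<equiv> a\<close> modulo \<open>w*\<close>, either of the two identities \<open>gcd(W'\<^sub>1, W'\<^sub>3) = w*\<close> and
  \<open>gcd(W'\<^sub>2, W'\<^sub>4) = w*\<close> bounds the new value of \<open>w*\<close> by the old one, and then dividing by it makes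
  the opposite weights coprime.\<close>

lemma coprime_opposite_weights_exist:
  assumes a: "kollar_tuple a"
  obtains a' where "kollar_tuple a'" "a' 4 > K" "kollar_wstar a' = kollar_wstar a"
    "\<forall>j. int (kollar_wstar a) dvd int (a' j) - int (a j)"
    "gcd (kollar_weight a' 1) (kollar_weight a' 3) = 1"
    "gcd (kollar_weight a' 2) (kollar_weight a' 4) = 1"
proof -
  define N where "N = kollar_wstar a"
  have N: "N > 0" using kollar_wstar_pos[OF a] by (simp add: N_def)
  have a0: "a i > 0" for i using a by (simp add: kollar_tuple_def)
  have NW: "int N dvd int (kollar_W a i)" for i
    using kollar_wstar_dvd by (simp add: N_def)
  obtain k1 k2 k3 k4 :: nat and b1 b2 b3 b4 :: int
    where k: "k1 > 0" "k2 > 0" "k3 > 0" "k4 > K"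
    and b: "b1 = int (a 1) + int N * int k1" "b2 = int (a 2) + int N * int k2"
      "b3 = int (a 3) + int N * int k3" "b4 = int (a 4) + int N * int k4"
    and g13: "gcd (b2 * b3 * b4 - b3 * b4 + b4 - 1) (b4 * b1 * b2 - b1 * b2 + b2 - 1) = int N"
    and g24: "gcd (b3 * b4 * b1 - b4 * b1 + b1 - 1) (b1 * b2 * b3 - b2 * b3 + b3 - 1) = int N"
    by (rule congruent_numbers_with_prescribed_gcds[of "int N" "int (a 1)" "int (a 2)" "int (a 3)" "int (a 4)" K])
      (use N a0 NW[of 1] NW[of 2] NW[of 3] NW[of 4] in \<open>simp_all only: kollar_W_values[OF a] of_nat_0_less_iff\<close>)
  define a' where "a' = (\<lambda>i :: 4. a i + N * (if i = 1 then k1 else if i = 2 then k2 else if i = 3 then k3 else k4))"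
  have a'b: "int (a' 1) = b1" "int (a' 2) = b2" "int (a' 3) = b3" "int (a' 4) = b4"
    by (simp_all add: a'_def b)
  have "a' i > 1" for i
  proof -
    have "N * (if i = 1 then k1 else if i = 2 then k2 else if i = 3 then k3 else k4) > 0"
      using N k by auto
    then show ?thesis using a0[of i] unfolding a'_def by linarith
  qed
  then have "a' i \<noteq> 1" "a' i > 0" for i
    by (metis less_irrefl, metis less_trans zero_less_one)
  then have a': "kollar_tuple a'" by (simp add: kollar_tuple_def)
  have "int (gcd (kollar_W a' 1) (kollar_W a' 3)) = int N" "int (gcd (kollar_W a' 2) (kollar_W a' 4)) = int N"
    unfolding gcd_int_int_eq[symmetric] kollar_W_values[OF a'] a'b by (rule g13, rule g24)
  then have gW: "gcd (kollar_W a' 1) (kollar_W a' 3) = N" "gcd (kollar_W a' 2) (kollar_W a' 4) = N"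
    by simp_all
  have "N dvd kollar_W a' 1" "N dvd kollar_W a' 2" "N dvd kollar_W a' 3" "N dvd kollar_W a' 4"
    using gW by (metis gcd_dvd1, metis gcd_dvd1, metis gcd_dvd2, metis gcd_dvd2)
  then have "N dvd kollar_W a' i" for i using exhaust_4[of i] by auto
  then have "N dvd kollar_wstar a'" unfolding kollar_wstar_def by (auto intro: Gcd_greatest)
  moreover have "kollar_wstar a' dvd N"
    using gcd_greatest[OF kollar_wstar_dvd[of a' 1] kollar_wstar_dvd[of a' 3]] gW(1) by simp
  ultimately have wstar: "kollar_wstar a' = N" by (rule dvd_antisym[rotated])
  have "N * gcd (kollar_weight a' 1) (kollar_weight a' 3) = N"
    "N * gcd (kollar_weight a' 2) (kollar_weight a' 4) = N"
    using gW by (simp_all add: gcd_mult_distrib_nat kollar_W_eq wstar)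
  then have gw: "gcd (kollar_weight a' 1) (kollar_weight a' 3) = 1"
    "gcd (kollar_weight a' 2) (kollar_weight a' 4) = 1"
    using N by simp_all
  have "k4 \<le> a 4 + N * k4" using N by (simp add: trans_le_add2)
  then have big: "a' 4 > K" using k(4) unfolding a'_def by simp
  have cong: "int N dvd int (a' j) - int (a j)" for j by (simp add: a'_def)
  show thesis
    by (rule that[OF a' big]) (use wstar cong gw in \<open>simp_all add: N_def\<close>)
qed

theorem theorem5p1:
  fixes a :: "4 \<Rightarrow> nat"
  assumes "kollar_tuple a"
  shows "infinite {a' :: 4 \<Rightarrow> nat. kollar_tuple a' \<and>
           gcd (kollar_weight a' 1) (kollar_weight a' 3) = 1 \<and>
           gcd (kollar_weight a' 2) (kollar_weight a' 4) = 1 \<and>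
           birational (kollar_weight a) (kollar_surface a) (kollar_weight a') (kollar_surface a')}"
    (is "infinite ?S")
proof
  assume "finite ?S"
  then have "finite ((\<lambda>a'. a' 4) ` ?S)" by (rule finite_imageI)
  then obtain K where K: "\<forall>n \<in> (\<lambda>a'. a' 4) ` ?S. n \<le> K"
    unfolding finite_nat_set_iff_bounded_le by (rule exE)
  obtain a' where a': "kollar_tuple a'" "a' 4 > K" "kollar_wstar a' = kollar_wstar a"
    "\<forall>j. int (kollar_wstar a) dvd int (a' j) - int (a j)"
    "gcd (kollar_weight a' 1) (kollar_weight a' 3) = 1"
    "gcd (kollar_weight a' 2) (kollar_weight a' 4) = 1"
    by (rule coprime_opposite_weights_exist[OF assms, of K])
  have "a' \<in> ?S"
    unfolding mem_Collect_eq by (intro conjI kollar_surface_birational assms a'(1,3,5,6) a'(4)[rule_format])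
  then have "a' 4 \<le> K" by (intro bspec[OF K] imageI)
  then show False using a'(2) by simp
qed

end
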